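(* Let $\{\vec{x}_i,\vec{y}_i\}_{i\in[N]}$ be a given dataset with $\vec{x}_i\in\mathbb{R}^d$ and $\vec{y}_i\in[m]$. Let $\mathfrak{Q}:\mathbb{R}^d\to\mathbb{R}^d$ be a non-zero affine map such that $\mathfrak{Q}\vec{x}_i\geqslant0$ (componentwise) for all $i\in[N]$. Set $\mathbf{x}^0_i:=\mathfrak{Q}\vec{x}_i$ for $i\in[N]$, and let $P\in\mathbb{R}^{m\times d}$ be any non-zero matrix such that the ReLU system $$\dot{\mathbf{x}}_i(t)=\sigma\big(w(t)\mathbf{x}_i(t)+b(t)\big)\ \text{ in }(0,T_0),\qquad \mathbf{x}_i(0)=\mathbf{x}^0_i,\qquad i\in[N],\qquad \sigma(x)=\max\{x,0\},$$ separates the dataset $\{\mathbf{x}^0_i,\vec{y}_i\}_{i\in[N]}$ with respect to $P$ in some time $T_0>0$, and let $\gamma>0$ denote the associated margin (i.e. the margin at time $T_0$ of the separating parameters). Fix $T\geqslant T_0$ and, for any $\lambda>0$, let $[w_\lambda,b_\lambda]\in H^1(0,T;\mathbb{R}^{d_u})$ be any pair of global minimizers of $$J_{\lambda,T}(w,b)=\mathscr{E}(\mathbf{x}(T))+\lambda\big\|[w,b]\big\|^2_{H^1(0,T;\mathbb{R}^{d_u})},\qquad \mathscr{E}(\mathbf{x})=\frac1N\sum_{i=1}^N-\log\left(\frac{e^{(P\mathbf{x}_i)_{\vec{y}_i}}}{\sum_{j=1}^m e^{(P\mathbf{x}_i)_j}}\right),$$ where $\mathbf{x}=(\mathbf{x}_1,\dots,\mathbf{x}_N)$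 is the solution of the ReLU system on $[0,T]$ with parameters $[w,b]$ and initial data $\mathbf{x}^0_i$, and let $\mathbf{x}_\lambda(\cdot)$ be the unique solution associated to $[w_\lambda,b_\lambda]$. Then there exists a constant $\mathfrak{C}=\mathfrak{C}(\{\vec{x}_i,\vec{y}_i\}_{i\in[N]},T)>0$ independent of $\lambda>0$ such that $$\mathscr{E}(\mathbf{x}_\lambda(T))\leqslant\log\left(1+(m-1)e^{-\gamma\,e^{\frac{\lambda^{-\alpha}}{2}}}\right)+\mathfrak{C}\,\lambda^{-2\alpha+1}$$ holds for any $\alpha\in\left(0,\tfrac12\right)$.
   Context: Write $[n]=\{1,\dots,n\}$; $m\geqslant2$ is the number of classes, and $\vec{x}_i\neq\vec{x}_j$ for $i\neq j$. $\mathbb{R}^{d_u}:=\mathbb{R}^{d\times(d+1)}$; its elements are pairs $[w,b]$ with $w\in\mathbb{R}^{d\times d}$, $b\in\mathbb{R}^d$. $\sigma$ acts componentwise on vectors. $\|f\|_{H^1}^2=\|f\|_{L^2}^2+\|\dot f\|_{L^2}^2$. Separation: the system above separates the dataset $\{\mathbf{x}_i^0,\vec{y}_i\}_{i\in[N]}$ with respect to $P$ in time $T_0$ if there exist parameters $[w,b]\in H^1(0,T_0;\mathbb{R}^{d_u})$ such that the corresponding solution satisfies $(P\mathbf{x}_i(T_0))_{\vec{y}_i}-\max_{j\in[m],\,j\neq\vec{y}_i}(P\mathbf{x}_i(T_0))_j>0$ for all $i\in[N]$. The corresponding margin is $$\gamma=\min_{i\in[N]}\Big((P\mathbf{x}_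i(T_0))_{\vec{y}_i}-\max_{j\in[m],\,j\neq\vec{y}_i}(P\mathbf{x}_i(T_0))_j\Big).$$
   Formalization: The constant C may depend on P, Q, T_0 and the separating parameters (hence gamma) as well as on the dataset and T; with dependence on the dataset and T alone the claim fails (d=N=1, m=2, P=(p,0)^T, p→0 at fixed gamma). It stays independent of lambda, alpha and the minimizer. *)

theory Defs
  imports "HOL-Analysis.Analysis"
begin

section \<open>The Sobolev space \<open>H\<^sup>1(0,T)\<close>\<close>

text \<open>Functions are identified with arbitrary representatives of their a.e. class; nothing below
  depends on the values outside \<open>(0,T)\<close> or on a null set.\<close>

definition L2_on :: "real set \<Rightarrow> (real \<Rightarrow> 'a::euclidean_space) \<Rightarrow> bool" where
  "L2_on S f \<longleftrightarrow>
     set_borel_measurable lebesgue S f \<and> set_integrable lebesgue S (\<lambda>t. (norm (f t))\<^sup>2)"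

definition L2_norm_sq :: "real set \<Rightarrow> (real \<Rightarrow> 'a::euclidean_space) \<Rightarrow> real" where
  "L2_norm_sq S f = (LINT t:S|lebesgue. (norm (f t))\<^sup>2)"

text \<open>Test functions \<open>C\<^sub>c\<^sup>1(0,T)\<close>, extended by zero to the real line. The support is
  compact because it is closed and contained in a bounded interval.\<close>

definition test_function :: "real \<Rightarrow> (real \<Rightarrow> real) \<Rightarrow> bool" where
  "test_function T \<phi> \<longleftrightarrow>
     \<phi> C1_differentiable_on UNIV \<and> closure {t. \<phi> t \<noteq> 0} \<subseteq> {0<..<T}"

definition has_weak_deriv ::
    "real \<Rightarrow> (real \<Rightarrow> 'a::euclidean_space) \<Rightarrow> (real \<Rightarrow> 'a) \<Rightarrow> bool" where
  "has_weak_deriv T f g \<longleftrightarrow>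
     (\<forall>\<phi>. test_function T \<phi> \<longrightarrow>
        (LINT t:{0<..<T}|lebesgue. deriv \<phi> t *\<^sub>R f t)
        = - (LINT t:{0<..<T}|lebesgue. \<phi> t *\<^sub>R g t))"

definition H1 :: "real \<Rightarrow> (real \<Rightarrow> 'a::euclidean_space) set" where
  "H1 T = {f. L2_on {0<..<T} f \<and> (\<exists>g. L2_on {0<..<T} g \<and> has_weak_deriv T f g)}"

text \<open>Weak derivatives are unique almost everywhere on \<open>(0,T)\<close>, so the choice does not affect
  the norm.\<close>

definition weak_deriv :: "real \<Rightarrow> (real \<Rightarrow> 'a::euclidean_space) \<Rightarrow> real \<Rightarrow> 'a" where
  "weak_deriv T f = (SOME g. L2_on {0<..<T} g \<and> has_weak_deriv T f g)"

definition H1_norm_sq :: "real \<Rightarrow> (real \<Rightarrow> 'a::euclidean_space) \<Rightarrow> real" where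
  "H1_norm_sq T f = L2_norm_sq {0<..<T} f + L2_norm_sq {0<..<T} (weak_deriv T f)"


section \<open>The ReLU system\<close>

text \<open>The parameter space \<open>\<real>\<^bsup>d\<times>(d+1)\<^esup>\<close>. The norm of the product type is the Euclidean one,
  and the norm of a matrix is the Frobenius norm.\<close>

type_synonym 'd params = "(real ^ 'd ^ 'd) \<times> (real ^ 'd)"

definition relu :: "real ^ 'd \<Rightarrow> real ^ 'd" where
  "relu v = (\<chi> k. max (v $ k) 0)"

text \<open>Solutions in the sense of Caratheodory. For parameters in \<open>L\<^sup>2\<close> this does not
  depend on the representative; for the continuous representative of an \<open>H\<^sup>1\<close> parameter
  it is the same as being a classical solution.\<close>

definition relu_solution ::
    "real \<Rightarrow> (real \<Rightarrow> ('d::finite) params) \<Rightarrow> real ^ 'd \<Rightarrow> (real \<Rightarrow> real ^ 'd) \<Rightarrow> bool" where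
  "relu_solution T u x0 x \<longleftrightarrow>
     continuous_on {0..T} x \<and>
     (\<forall>t\<in>{0..T}.
        ((\<lambda>s. relu (fst (u s) *v x s + snd (u s))) has_integral (x t - x0)) {0..t})"

text \<open>For parameters in \<open>H\<^sup>1\<close> the solution exists and is unique on \<open>[0,T]\<close>; the values outside
  \<open>[0,T]\<close> are irrelevant.\<close>

definition relu_trajectory ::
    "real \<Rightarrow> (real \<Rightarrow> ('d::finite) params) \<Rightarrow> real ^ 'd \<Rightarrow> real \<Rightarrow> real ^ 'd" where
  "relu_trajectory T u x0 = (SOME x. relu_solution T u x0 x)"


section \<open>Margin, training error and regularised functional\<close>

definition sample_margin ::
    "real ^ 'd ^ 'm \<Rightarrow> 'm::finite \<Rightarrow> real ^ 'd::finite \<Rightarrow> real" where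
  "sample_margin P c v = (P *v v) $ c - Max ((\<lambda>j. (P *v v) $ j) ` {j. j \<noteq> c})"

definition margin ::
    "real ^ 'd ^ 'm \<Rightarrow> ('n::finite \<Rightarrow> 'm::finite) \<Rightarrow> ('n \<Rightarrow> real ^ 'd::finite) \<Rightarrow> real" where
  "margin P y X = Min (range (\<lambda>i. sample_margin P (y i) (X i)))"

definition training_error ::
    "real ^ 'd ^ 'm \<Rightarrow> ('n::finite \<Rightarrow> 'm::finite) \<Rightarrow> ('n \<Rightarrow> real ^ 'd::finite) \<Rightarrow> real" where
  "training_error P y X =
     1 / real CARD('n) *
     (\<Sum>i\<in>UNIV. - ln (exp ((P *v X i) $ y i) / (\<Sum>j\<in>UNIV. exp ((P *v X i) $ j))))"

definition J_functional ::
    "real ^ 'd ^ 'm \<Rightarrow> ('n::finite \<Rightarrow> 'm::finite) \<Rightarrow> ('n \<Rightarrow> real ^ 'd::finite) \<Rightarrow>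
     real \<Rightarrow> real \<Rightarrow> (real \<Rightarrow> 'd params) \<Rightarrow> real" where
  "J_functional P y x0 lam T u =
     training_error P y (\<lambda>i. relu_trajectory T u (x0 i) T) + lam * H1_norm_sq T u"

end

theory Submission
  imports Defs
begin

text \<open>
  For \<open>\<lambda> \<ge> 1\<close> the minimizer is compared with the zero control, whose cost is the initial training
  error. For \<open>\<lambda> < 1\<close> put \<open>R = \<lambda>\<^sup>-\<^sup>\<alpha> \<ge> 1\<close> and compare with \<open>\<rho> u\<^sub>0 + R \<psi> (I, 0)\<close>. Here \<open>\<rho>\<close> is a \<open>C\<^sup>1\<close> cutoff
  that equals 1 until shortly before \<open>T\<^sub>0\<close> and vanishes from some \<open>T\<^sub>2 < T\<^sub>0\<close> on, so \<open>\<rho> u\<^sub>0\<close> extends by zero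
  to an \<open>H\<^sup>1\<close> control on \<open>(0,T)\<close> even if \<open>T = T\<^sub>0\<close>. The switch-off is so late that every trajectory is
  close to its endpoint at \<open>T\<^sub>0\<close>, hence still has margin at least \<open>\<gamma>/2\<close>. From \<open>T\<^sub>2\<close> on the states are
  nonnegative, so the ReLU acts as the identity and the control \<open>R \<psi> (I, 0)\<close> multiplies them by
  \<open>exp (R \<integral> \<psi>)\<close>. The normalisation \<open>\<integral> \<psi> = 2\<close> makes the final margin at least
  \<open>exp (2 R) \<gamma> / 2 \<ge> \<gamma> exp (R / 2)\<close>, while the squared \<open>H\<^sup>1\<close> norm of the control is \<open>O(R\<^sup>2)\<close>, which
  contributes \<open>O(\<lambda> R\<^sup>2) = O(\<lambda>\<^sup>1\<^sup>-\<^sup>2\<^sup>\<alpha>)\<close> to the functional.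
\<close>

section \<open>Square-integrable functions and weak derivatives\<close>

lemma C1_differentiable_on_UNIV_I:
  fixes f :: "real \<Rightarrow> real"
  assumes "\<And>x. (f has_real_derivative f' x) (at x)" "continuous_on UNIV f'"
  shows "f C1_differentiable_on UNIV"
  using assms unfolding C1_differentiable_on_def has_real_derivative_iff_has_vector_derivative by blast

lemma C1_differentiable_on_UNIV_D:
  fixes f :: "real \<Rightarrow> real"
  assumes "f C1_differentiable_on UNIV"
  shows "(f has_real_derivative deriv f x) (at x)" "continuous_on UNIV (deriv f)" "continuous_on UNIV f"
proof -
  obtain D where D: "\<And>x. (f has_real_derivative D x) (at x)" "continuous_on UNIV D"
    using assms unfolding C1_differentiable_on_def has_real_derivative_iff_has_vector_derivative by blast
  then have "deriv f = D"
    using DERIV_imp_deriv by blast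
  with D show "(f has_real_derivative deriv f x) (at x)" "continuous_on UNIV (deriv f)" by auto
  show "continuous_on UNIV f"
    using D(1) by (meson DERIV_isCont continuous_at_imp_continuous_on)
qed

text \<open>The squared positive part is the building block of every cutoff and bump below. It
  vanishes on the left half-line and is C1, which suffices because test functions are only required
  to be C1.\<close>

definition pos_sq :: "real \<Rightarrow> real" where
  "pos_sq x = (max 0 x)\<^sup>2"

lemma pos_sq_has_derivative: "(pos_sq has_real_derivative 2 * max 0 x) (at x)"
proof -
  consider "x > 0" | "x < 0" | "x = 0" by linarith
  then show ?thesis
  proof cases
    case 1
    have "((\<lambda>x. x\<^sup>2) has_real_derivative 2 * max 0 x) (at x)"
      using 1 by (auto intro!: derivative_eq_intros)
    then show ?thesis
      by (rule has_field_derivative_transform_within_open[where S="{0<..}"]) (use 1 in \<open>auto simp: pos_sq_def\<close>)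
  next
    case 2
    have "((\<lambda>x. 0) has_real_derivative 2 * max 0 x) (at x)"
      using 2 by (auto intro!: derivative_eq_intros)
    then show ?thesis
      by (rule has_field_derivative_transform_within_open[where S="{..<0}"]) (use 2 in \<open>auto simp: pos_sq_def\<close>)
  next
    \<comment> \<open>At the junction the difference quotient is at most
      \<open>\<bar>h\<bar>\<close> in absolute value, so the two branches meet with slope 0.\<close>
    case 3
    have "((\<lambda>h. (pos_sq (0 + h) - pos_sq 0) / h) \<longlongrightarrow> 0) (at 0)"
    proof (rule Lim_null_comparison)
      show "\<forall>\<^sub>F h in at 0. norm ((pos_sq (0 + h) - pos_sq 0) / h) \<le> \<bar>h\<bar>"
        by (rule always_eventually) (auto simp: pos_sq_def max_def power2_eq_square)
      show "((\<lambda>h::real. \<bar>h\<bar>) \<longlongrightarrow> 0) (at 0)"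
        by (intro tendsto_rabs_zero tendsto_ident_at)
    qed
    then show ?thesis
      using 3 by (simp add: DERIV_def)
  qed
qed

lemmas pos_sq_derivative [derivative_intros] = DERIV_chain2[OF pos_sq_has_derivative]

lemma continuous_on_pos_sq [continuous_intros]:
  "continuous_on S f \<Longrightarrow> continuous_on S (\<lambda>x. pos_sq (f x))"
  unfolding pos_sq_def by (intro continuous_intros)

lemma pos_sq_nonneg [simp]: "0 \<le> pos_sq x"
  by (simp add: pos_sq_def)

lemma pos_sq_eq_0_iff [simp]: "pos_sq x = 0 \<longleftrightarrow> x \<le> 0"
  by (auto simp: pos_sq_def max_def)

lemma pos_sq_pos_iff [simp]: "0 < pos_sq x \<longleftrightarrow> 0 < x"
  by (auto simp: pos_sq_def max_def)

section \<open>Square-integrable functions\<close>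

text \<open>This is the extension by zero that carries a control from \<open>(0,b)\<close> to
  \<open>(0,T)\<close>: where \<open>h\<close> vanishes, the values of \<open>f\<close> beyond
  \<open>b\<close> do not enter. On \<open>(0,b)\<close> the factor \<open>h\<close> is bounded by
  compactness of \<open>{0..b}\<close>. For \<open>b = T\<close> the vanishing condition is vacuous,
  and the lemma is plain multiplication by a continuous function.\<close>

lemma L2_on_mult:
  fixes f :: "real \<Rightarrow> 'a::euclidean_space"
  assumes f: "L2_on {0<..<b} f" and h: "continuous_on UNIV h" and bT: "b \<le> T"
    and h0: "\<And>t. b \<le> t \<Longrightarrow> t < T \<Longrightarrow> h t = 0"
  shows "L2_on {0<..<T} (\<lambda>t. h t *\<^sub>R f t)"
proof -
  have eq: "indicat_real {0<..<T} t *\<^sub>R (h t *\<^sub>R f t) = h t *\<^sub>R (indicat_real {0<..<b} t *\<^sub>R f t)" for t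
    using bT h0[of t] by (auto simp: indicator_def)
  have [measurable]: "h \<in> borel_measurable lebesgue"
    using borel_measurable_continuous_onI[OF h] by (intro measurable_completion) simp
  have fm[measurable]: "(\<lambda>t. indicat_real {0<..<b} t *\<^sub>R f t) \<in> borel_measurable lebesgue"
    using f by (simp add: L2_on_def set_borel_measurable_def)
  have m: "(\<lambda>t. indicat_real {0<..<T} t *\<^sub>R (h t *\<^sub>R f t)) \<in> borel_measurable lebesgue"
    unfolding eq by measurable
  have "bounded (h ` {0..b})"
    by (intro compact_imp_bounded compact_continuous_image continuous_on_subset[OF h]) auto
  then obtain B where B: "\<And>t. t \<in> {0..b} \<Longrightarrow> \<bar>h t\<bar> \<le> B"
    unfolding bounded_iff real_norm_def by blast
  have eq2: "indicat_real {0<..<T} t *\<^sub>R (norm (h t *\<^sub>R f t))\<^sup>2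
      = (norm (indicat_real {0<..<T} t *\<^sub>R (h t *\<^sub>R f t)))\<^sup>2" for t
    by (auto simp: indicator_def)
  have "integrable lebesgue (\<lambda>t. indicat_real {0<..<T} t *\<^sub>R (norm (h t *\<^sub>R f t))\<^sup>2)"
  proof (rule Bochner_Integration.integrable_bound)
    show "integrable lebesgue (\<lambda>t. B\<^sup>2 * (indicat_real {0<..<b} t *\<^sub>R (norm (f t))\<^sup>2))"
      using f by (simp add: L2_on_def set_integrable_def)
    show "(\<lambda>t. indicat_real {0<..<T} t *\<^sub>R (norm (h t *\<^sub>R f t))\<^sup>2) \<in> borel_measurable lebesgue"
      unfolding eq2 using m by measurable
    show "AE t in lebesgue. norm (indicat_real {0<..<T} t *\<^sub>R (norm (h t *\<^sub>R f t))\<^sup>2)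
        \<le> norm (B\<^sup>2 * (indicat_real {0<..<b} t *\<^sub>R (norm (f t))\<^sup>2))"
    proof (rule AE_I2)
      fix t
      have "(h t)\<^sup>2 * (norm (f t))\<^sup>2 \<le> B\<^sup>2 * (norm (f t))\<^sup>2" if "t \<in> {0..b}"
        using abs_le_square_iff[of "h t" B] B[OF that] by (intro mult_right_mono) auto
      then show "norm (indicat_real {0<..<T} t *\<^sub>R (norm (h t *\<^sub>R f t))\<^sup>2)
        \<le> norm (B\<^sup>2 * (indicat_real {0<..<b} t *\<^sub>R (norm (f t))\<^sup>2))"
        using h0[of t] by (auto simp: indicator_def power_mult_distrib)
    qed
  qed
  with m show ?thesis
    by (simp add: L2_on_def set_borel_measurable_def set_integrable_def)
qed

lemma norm_add_sq_le: "(norm (a + b))\<^sup>2 \<le> 2 * (norm a)\<^sup>2 + 2 * (norm b)\<^sup>2"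
proof -
  have "(norm (a + b))\<^sup>2 \<le> (norm a + norm b)\<^sup>2"
    by (intro power_mono norm_triangle_ineq) auto
  also have "\<dots> \<le> 2 * (norm a)\<^sup>2 + 2 * (norm b)\<^sup>2"
    using sum_squares_bound[of "norm a" "norm b"] by (simp add: power2_sum)
  finally show ?thesis .
qed

lemma L2_on_add:
  fixes f g :: "real \<Rightarrow> 'a::euclidean_space"
  assumes f: "L2_on S f" and g: "L2_on S g"
  shows "L2_on S (\<lambda>t. f t + g t)"
    and "L2_norm_sq S (\<lambda>t. f t + g t) \<le> 2 * L2_norm_sq S f + 2 * L2_norm_sq S g"
proof -
  have [measurable]: "(\<lambda>t. indicat_real S t *\<^sub>R f t) \<in> borel_measurable lebesgue"
    "(\<lambda>t. indicat_real S t *\<^sub>R g t) \<in> borel_measurable lebesgue"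
    using f g by (auto simp: L2_on_def set_borel_measurable_def)
  have m: "(\<lambda>t. indicat_real S t *\<^sub>R (f t + g t)) \<in> borel_measurable lebesgue"
    unfolding scaleR_add_right by measurable
  have eq2: "indicat_real S t *\<^sub>R (norm (f t + g t))\<^sup>2
      = (norm (indicat_real S t *\<^sub>R (f t + g t)))\<^sup>2" for t
    by (auto simp: indicator_def)
  have i1: "integrable lebesgue (\<lambda>t. indicat_real S t *\<^sub>R (norm (f t))\<^sup>2)"
    "integrable lebesgue (\<lambda>t. indicat_real S t *\<^sub>R (norm (g t))\<^sup>2)"
    using f g by (auto simp: L2_on_def set_integrable_def)
  have i2: "integrable lebesgue (\<lambda>t. 2 * (indicat_real S t *\<^sub>R (norm (f t))\<^sup>2) + 2 * (indicat_real S t *\<^sub>R (norm (g t))\<^sup>2))"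
    using i1 by auto
  have i: "integrable lebesgue (\<lambda>t. indicat_real S t *\<^sub>R (norm (f t + g t))\<^sup>2)"
  proof (rule Bochner_Integration.integrable_bound[OF i2])
    show "(\<lambda>t. indicat_real S t *\<^sub>R (norm (f t + g t))\<^sup>2) \<in> borel_measurable lebesgue"
      unfolding eq2 using m by measurable
  qed (auto simp: indicator_def norm_add_sq_le)
  with m show "L2_on S (\<lambda>t. f t + g t)"
    by (simp add: L2_on_def set_borel_measurable_def set_integrable_def)
  have "L2_norm_sq S (\<lambda>t. f t + g t) \<le> integral\<^sup>L lebesgue (\<lambda>t. 2 * (indicat_real S t *\<^sub>R (norm (f t))\<^sup>2) + 2 * (indicat_real S t *\<^sub>R (norm (g t))\<^sup>2))"
    unfolding L2_norm_sq_def set_lebesgue_integral_def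
    by (rule integral_mono[OF i i2]) (auto simp: indicator_def norm_add_sq_le)
  also have "\<dots> = 2 * L2_norm_sq S f + 2 * L2_norm_sq S g"
    unfolding L2_norm_sq_def set_lebesgue_integral_def using i1
    by (subst Bochner_Integration.integral_add) auto
  finally show "L2_norm_sq S (\<lambda>t. f t + g t) \<le> 2 * L2_norm_sq S f + 2 * L2_norm_sq S g" .
qed

lemma L2_on_scaleR:
  fixes f :: "real \<Rightarrow> 'a::euclidean_space"
  assumes "L2_on S f"
  shows "L2_on S (\<lambda>t. c *\<^sub>R f t)"
    and "L2_norm_sq S (\<lambda>t. c *\<^sub>R f t) = c\<^sup>2 * L2_norm_sq S f"
proof -
  have m: "(\<lambda>t. indicat_real S t *\<^sub>R f t) \<in> borel_measurable lebesgue"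
    using assms by (auto simp: L2_on_def set_borel_measurable_def)
  have eq: "indicat_real S t *\<^sub>R c *\<^sub>R f t = c *\<^sub>R indicat_real S t *\<^sub>R f t" for t
    by simp
  have "(\<lambda>t. indicat_real S t *\<^sub>R c *\<^sub>R f t) \<in> borel_measurable lebesgue"
    unfolding eq using m by measurable
  moreover have "set_integrable lebesgue S (\<lambda>t. (norm (c *\<^sub>R f t))\<^sup>2)"
    using assms by (auto simp: L2_on_def power_mult_distrib)
  ultimately show "L2_on S (\<lambda>t. c *\<^sub>R f t)"
    by (simp add: L2_on_def set_borel_measurable_def)
  show "L2_norm_sq S (\<lambda>t. c *\<^sub>R f t) = c\<^sup>2 * L2_norm_sq S f"
    by (simp add: L2_norm_sq_def power_mult_distrib)
qed

lemma L2_norm_sq_nonneg: "0 \<le> L2_norm_sq S f"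
  unfolding L2_norm_sq_def set_lebesgue_integral_def by (rule Bochner_Integration.integral_nonneg) auto

lemma L2_on_const: "L2_on {0<..<T} (\<lambda>_. c :: 'a::euclidean_space)"
proof -
  have "set_borel_measurable lebesgue {0<..<T} (\<lambda>_. c)"
    unfolding set_borel_measurable_def by (intro borel_measurable_scaleR borel_measurable_indicator) auto
  moreover have "set_integrable lebesgue {0<..<T} (\<lambda>t. (norm c)\<^sup>2)"
    by (simp add: absolutely_integrable_on_const)
  ultimately show ?thesis by (simp add: L2_on_def)
qed

text \<open>On a bounded interval constants are integrable, and
  \<open>norm (f t) \<le> 1 + (norm (f t))\<^sup>2\<close> supplies the integrable dominant.\<close>

lemma L2_on_imp_absolutely_integrable:
  fixes f :: "real \<Rightarrow> 'a::euclidean_space"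
  assumes "L2_on {0<..<T} f"
  shows "f absolutely_integrable_on {0<..<T}"
  unfolding set_integrable_def
proof (rule Bochner_Integration.integrable_bound)
  have "set_integrable lebesgue {0<..<T} (\<lambda>t. 1::real)"
    by (simp add: absolutely_integrable_on_const)
  moreover have "set_integrable lebesgue {0<..<T} (\<lambda>t. (norm (f t))\<^sup>2)"
    using assms by (simp add: L2_on_def)
  ultimately show "integrable lebesgue (\<lambda>t. indicat_real {0<..<T} t *\<^sub>R (1 + (norm (f t))\<^sup>2))"
    unfolding set_integrable_def[symmetric] by (rule set_integral_add)
  show "(\<lambda>t. indicat_real {0<..<T} t *\<^sub>R f t) \<in> borel_measurable lebesgue"
    using assms by (simp add: L2_on_def set_borel_measurable_def)
  have "norm (f t) \<le> 1 + (norm (f t))\<^sup>2" for t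
  proof -
    have "2 * norm (f t) \<le> 1 + (norm (f t))\<^sup>2"
      using sum_squares_bound[of "norm (f t)" 1] by simp
    with norm_ge_zero[of "f t"] show ?thesis by linarith
  qed
  then show "AE t in lebesgue. norm (indicat_real {0<..<T} t *\<^sub>R f t)
      \<le> norm (indicat_real {0<..<T} t *\<^sub>R (1 + (norm (f t))\<^sup>2))"
    by (auto simp: indicator_def)
qed

lemma absolutely_integrable_continuous_mult:
  fixes f :: "real \<Rightarrow> 'a::euclidean_space"
  assumes f: "f absolutely_integrable_on {0<..<T}" and h: "continuous_on UNIV h"
  shows "(\<lambda>t. h t *\<^sub>R f t) absolutely_integrable_on {0<..<T}"
proof (rule absolutely_integrable_bounded_measurable_product[where h="\<lambda>(a::real) (x::'a). a *\<^sub>R x", OF _ _ _ _ f])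
  show "bilinear (\<lambda>(a::real) (x::'a). a *\<^sub>R x)"
    using bilinear_conv_bounded_bilinear bounded_bilinear_scaleR by blast
  show "h \<in> borel_measurable (lebesgue_on {0<..<T})"
    by (rule continuous_imp_measurable_on_sets_lebesgue) (auto intro: continuous_on_subset[OF h])
  have "bounded (h ` {0..T})"
    by (intro compact_imp_bounded compact_continuous_image continuous_on_subset[OF h]) auto
  then show "bounded (h ` {0<..<T})"
    by (rule bounded_subset) auto
qed auto

section \<open>Calculus of weak derivatives\<close>

lemma test_functionD:
  assumes "test_function T \<phi>"
  shows "\<phi> C1_differentiable_on UNIV" "t \<notin> {0<..<T} \<Longrightarrow> \<phi> t = 0"
  using assms closure_subset[of "{t. \<phi> t \<noteq> 0}"] unfolding test_function_def by auto

text \<open>A test function \<open>\<phi>\<close> on \<open>(0,T)\<close> may have support reaching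
  beyond \<open>b\<close>, but the support of \<open>\<phi> t * h t\<close> also lies in
  \<open>{..c}\<close>, hence inside \<open>(0,b)\<close> because \<open>c < b\<close> is strict.
  Testing the weak derivative of \<open>f\<close> with this product and expanding its derivative
  gives the product rule and the extension by zero at once.\<close>

lemma has_weak_deriv_cutoff:
  fixes f g :: "real \<Rightarrow> 'a::euclidean_space"
  assumes f: "f absolutely_integrable_on {0<..<b}" and g: "g absolutely_integrable_on {0<..<b}"
    and fg: "has_weak_deriv b f g"
    and h: "\<And>t. (h has_real_derivative h' t) (at t)" "continuous_on UNIV h'"
    and h0: "\<And>t. c \<le> t \<Longrightarrow> h t = 0" "\<And>t. c \<le> t \<Longrightarrow> h' t = 0"
    and cb: "c < b" "b \<le> T"
  shows "has_weak_deriv T (\<lambda>t. h t *\<^sub>R f t) (\<lambda>t. h t *\<^sub>R g t + h' t *\<^sub>R f t)"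
  unfolding has_weak_deriv_def
proof (intro allI impI)
  fix \<phi> assume tf: "test_function T \<phi>"
  note \<phi> = C1_differentiable_on_UNIV_D[OF test_functionD(1)[OF tf]]
  have hC1: "h C1_differentiable_on UNIV"
    using h by (rule C1_differentiable_on_UNIV_I)
  note hc = C1_differentiable_on_UNIV_D(3)[OF hC1]
  have sub: "{t. \<phi> t * h t \<noteq> 0} \<subseteq> closure {t. \<phi> t \<noteq> 0} \<inter> {..c}"
  proof
    fix t assume "t \<in> {t. \<phi> t * h t \<noteq> 0}"
    then have "\<phi> t \<noteq> 0" "\<not> c \<le> t" using h0(1)[of t] by auto
    then show "t \<in> closure {t. \<phi> t \<noteq> 0} \<inter> {..c}"
      using closure_subset[of "{t. \<phi> t \<noteq> 0}"] by auto
  qed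
  have "closure {t. \<phi> t * h t \<noteq> 0} \<subseteq> closure {t. \<phi> t \<noteq> 0} \<inter> {..c}"
    by (rule closure_minimal[OF sub]) auto
  also have "\<dots> \<subseteq> {0<..<b}"
    using tf cb by (auto simp: test_function_def)
  finally have "test_function b (\<lambda>t. \<phi> t * h t)"
    unfolding test_function_def using test_functionD(1)[OF tf] hC1 by auto
  then have wd: "(LINT t:{0<..<b}|lebesgue. deriv (\<lambda>t. \<phi> t * h t) t *\<^sub>R f t)
      = - (LINT t:{0<..<b}|lebesgue. (\<phi> t * h t) *\<^sub>R g t)"
    using fg by (simp add: has_weak_deriv_def)
  have d: "deriv (\<lambda>t. \<phi> t * h t) t = deriv \<phi> t * h t + \<phi> t * h' t" for t
    by (rule DERIV_imp_deriv) (use \<phi>(1)[of t] h(1)[of t] in \<open>auto intro!: derivative_eq_intros\<close>)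
  have i1: "(\<lambda>t. (deriv \<phi> t * h t) *\<^sub>R f t) absolutely_integrable_on {0<..<b}"
    by (intro absolutely_integrable_continuous_mult f continuous_intros \<phi> hc)
  have i2: "(\<lambda>t. (\<phi> t * h' t) *\<^sub>R f t) absolutely_integrable_on {0<..<b}"
    by (intro absolutely_integrable_continuous_mult f continuous_intros \<phi> h)
  have i3: "(\<lambda>t. (\<phi> t * h t) *\<^sub>R g t) absolutely_integrable_on {0<..<b}"
    by (intro absolutely_integrable_continuous_mult g continuous_intros \<phi> hc)
  \<comment> \<open>The integrands in question vanish from \<open>c\<close> on, so integrating up to
    \<open>b\<close> or up to \<open>T\<close> gives the same value.\<close>
  have ext: "(LINT t:{0<..<T}|lebesgue. k t) = (LINT t:{0<..<b}|lebesgue. k t)"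
    if "\<And>t. c \<le> t \<Longrightarrow> k t = 0" for k :: "real \<Rightarrow> 'a"
    unfolding set_lebesgue_integral_def
    by (rule Bochner_Integration.integral_cong) (use cb that in \<open>auto simp: indicator_def not_less\<close>)
  have "(LINT t:{0<..<T}|lebesgue. deriv \<phi> t *\<^sub>R h t *\<^sub>R f t)
      = (LINT t:{0<..<b}|lebesgue. (deriv \<phi> t * h t) *\<^sub>R f t)"
    by (subst ext) (auto simp: h0)
  also have "\<dots> = (LINT t:{0<..<b}|lebesgue. deriv (\<lambda>t. \<phi> t * h t) t *\<^sub>R f t - (\<phi> t * h' t) *\<^sub>R f t)"
    by (simp add: d algebra_simps)
  also have "\<dots> = (LINT t:{0<..<b}|lebesgue. deriv (\<lambda>t. \<phi> t * h t) t *\<^sub>R f t)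
      - (LINT t:{0<..<b}|lebesgue. (\<phi> t * h' t) *\<^sub>R f t)"
    unfolding d scaleR_add_left by (intro set_integral_diff set_integral_add i1 i2)
  also have "\<dots> = - (LINT t:{0<..<b}|lebesgue. (\<phi> t * h t) *\<^sub>R g t + (\<phi> t * h' t) *\<^sub>R f t)"
    unfolding wd by (subst set_integral_add(2)[OF i3 i2]) simp
  also have "\<dots> = - (LINT t:{0<..<T}|lebesgue. \<phi> t *\<^sub>R (h t *\<^sub>R g t + h' t *\<^sub>R f t))"
    by (subst ext) (auto simp: h0 algebra_simps)
  finally show "(LINT t:{0<..<T}|lebesgue. deriv \<phi> t *\<^sub>R h t *\<^sub>R f t)
      = - (LINT t:{0<..<T}|lebesgue. \<phi> t *\<^sub>R (h t *\<^sub>R g t + h' t *\<^sub>R f t))" .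
qed

text \<open>Integration by parts: \<open>\<phi> t * h t\<close> vanishes at \<open>0\<close> and at
  \<open>T\<close>, so the fundamental theorem of calculus makes the integral of its derivative
  0.\<close>

lemma has_weak_deriv_C1:
  fixes c :: "'a::euclidean_space"
  assumes h: "\<And>t. (h has_real_derivative h' t) (at t)" "continuous_on UNIV h'" and "0 < T"
  shows "has_weak_deriv T (\<lambda>t. h t *\<^sub>R c) (\<lambda>t. h' t *\<^sub>R c)"
  unfolding has_weak_deriv_def
proof (intro allI impI)
  fix \<phi> assume tf: "test_function T \<phi>"
  note \<phi> = C1_differentiable_on_UNIV_D[OF test_functionD(1)[OF tf]]
  note hc = C1_differentiable_on_UNIV_D(3)[OF C1_differentiable_on_UNIV_I[OF h]]
  have c: "(\<lambda>t. c) absolutely_integrable_on {0<..<T}"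
    by (simp add: absolutely_integrable_on_const)
  have i1: "(\<lambda>t. (deriv \<phi> t * h t) *\<^sub>R c) absolutely_integrable_on {0<..<T}"
    by (intro absolutely_integrable_continuous_mult c continuous_intros \<phi> hc)
  have i2: "(\<lambda>t. (\<phi> t * h' t) *\<^sub>R c) absolutely_integrable_on {0<..<T}"
    by (intro absolutely_integrable_continuous_mult c continuous_intros \<phi> h)
  have "((\<lambda>t. (deriv \<phi> t * h t) *\<^sub>R c + (\<phi> t * h' t) *\<^sub>R c) has_integral
      (\<phi> T * h T) *\<^sub>R c - (\<phi> 0 * h 0) *\<^sub>R c) {0..T}"
  proof (rule fundamental_theorem_of_calculus)
    fix t
    have "((\<lambda>t. \<phi> t * h t) has_real_derivative deriv \<phi> t * h t + \<phi> t * h' t) (at t within {0..T})"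
      using \<phi>(1)[of t] h(1)[of t]
      by (auto intro!: derivative_eq_intros intro: DERIV_subset has_field_derivative_at_within)
    then show "((\<lambda>t. (\<phi> t * h t) *\<^sub>R c) has_vector_derivative
        (deriv \<phi> t * h t) *\<^sub>R c + (\<phi> t * h' t) *\<^sub>R c) (at t within {0..T})"
      using has_vector_derivative_scaleR[OF _ has_vector_derivative_const[of c]]
      by (fastforce simp: scaleR_add_left)
  qed (use assms in auto)
  then have "((\<lambda>t. (deriv \<phi> t * h t) *\<^sub>R c + (\<phi> t * h' t) *\<^sub>R c) has_integral 0) {0<..<T}"
    using test_functionD(2)[OF tf, of 0] test_functionD(2)[OF tf, of T]
    by (simp add: has_integral_Icc_iff_Ioo)
  then have "(LINT t:{0<..<T}|lebesgue. (deriv \<phi> t * h t) *\<^sub>R c + (\<phi> t * h' t) *\<^sub>R c) = 0"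
    using set_lebesgue_integral_eq_integral(2)[OF set_integral_add(1)[OF i1 i2]]
    by (simp add: integral_unique)
  then have "(LINT t:{0<..<T}|lebesgue. (deriv \<phi> t * h t) *\<^sub>R c)
      = - (LINT t:{0<..<T}|lebesgue. (\<phi> t * h' t) *\<^sub>R c)"
    unfolding set_integral_add(2)[OF i1 i2] by (simp add: eq_neg_iff_add_eq_0)
  then show "(LINT t:{0<..<T}|lebesgue. deriv \<phi> t *\<^sub>R h t *\<^sub>R c)
      = - (LINT t:{0<..<T}|lebesgue. \<phi> t *\<^sub>R h' t *\<^sub>R c)"
    by simp
qed

lemma has_weak_deriv_add:
  fixes f g :: "real \<Rightarrow> 'a::euclidean_space"
  assumes "has_weak_deriv T f f'" "has_weak_deriv T g g'"
    and "f absolutely_integrable_on {0<..<T}" "g absolutely_integrable_on {0<..<T}"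
    and "f' absolutely_integrable_on {0<..<T}" "g' absolutely_integrable_on {0<..<T}"
  shows "has_weak_deriv T (\<lambda>t. f t + g t) (\<lambda>t. f' t + g' t)"
  unfolding has_weak_deriv_def
proof (intro allI impI)
  fix \<phi> assume tf: "test_function T \<phi>"
  note \<phi> = C1_differentiable_on_UNIV_D[OF test_functionD(1)[OF tf]]
  show "(LINT t:{0<..<T}|lebesgue. deriv \<phi> t *\<^sub>R (f t + g t))
      = - (LINT t:{0<..<T}|lebesgue. \<phi> t *\<^sub>R (f' t + g' t))"
    unfolding scaleR_add_right
    apply (subst (1 2) set_integral_add(2))
    using assms(1,2) tf
    by (auto simp: has_weak_deriv_def intro!: absolutely_integrable_continuous_mult assms \<phi>)
qed

lemma has_weak_deriv_scaleR:
  assumes "has_weak_deriv T f f'"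
  shows "has_weak_deriv T (\<lambda>t. c *\<^sub>R f t) (\<lambda>t. c *\<^sub>R f' t)"
  unfolding has_weak_deriv_def
proof (intro allI impI)
  fix \<phi> assume "test_function T \<phi>"
  then have "(LINT t:{0<..<T}|lebesgue. deriv \<phi> t *\<^sub>R f t) = - (LINT t:{0<..<T}|lebesgue. \<phi> t *\<^sub>R f' t)"
    using assms by (simp add: has_weak_deriv_def)
  then have "c *\<^sub>R (LINT t:{0<..<T}|lebesgue. deriv \<phi> t *\<^sub>R f t) = - (c *\<^sub>R (LINT t:{0<..<T}|lebesgue. \<phi> t *\<^sub>R f' t))"
    by simp
  then show "(LINT t:{0<..<T}|lebesgue. deriv \<phi> t *\<^sub>R c *\<^sub>R f t) = - (LINT t:{0<..<T}|lebesgue. \<phi> t *\<^sub>R c *\<^sub>R f' t)"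
    unfolding set_integral_scaleR_right[symmetric] by (simp add: mult.commute)
qed

section \<open>Uniqueness of weak derivatives and evaluation of the H1 norm\<close>

text \<open>The Borel sets over which \<open>f\<close> integrates to 0 form a Dynkin system, with
  \<open>UNIV_zero\<close> serving the complements. Open intervals are an intersection-stable
  generator, so all Borel sets are covered. Lebesgue sets follow up to null sets, and a function
  with zero integral over every measurable set vanishes almost everywhere.\<close>

lemma AE_zero_if_interval_integrals_zero:
  fixes f :: "real \<Rightarrow> 'a::euclidean_space"
  assumes f: "integrable lebesgue f" and zero: "\<And>a b. (LINT t:{a<..<b}|lebesgue. f t) = 0"
    and UNIV_zero: "(LINT t|lebesgue. f t) = 0"
  shows "AE t in lebesgue. f t = 0"
proof -
  \<comment> \<open>\<open>density_zero\<close> is a fact about sigma-finite measures. A countable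
    cover of finite measure for \<open>lborel\<close> serves unchanged for its completion.\<close>
  interpret sigma_finite_measure "lebesgue :: real measure"
  proof
    obtain A :: "real set set" where "countable A" "A \<subseteq> sets lborel" "\<Union>A = space lborel"
      "\<forall>a\<in>A. emeasure lborel a \<noteq> \<infinity>"
      using lborel.sigma_finite_countable by metis
    then show "\<exists>A :: real set set. countable A \<and> A \<subseteq> sets lebesgue \<and> \<Union>A = space lebesgue \<and>
        (\<forall>a\<in>A. emeasure lebesgue a \<noteq> \<infinity>)"
      by (intro exI[of _ A]) auto
  qed
  have sets_borel: "sets borel = sigma_sets UNIV (range (\<lambda>(a, b). {a<..<b::real}))"
    by (subst borel_eq_box) (simp add: case_prod_unfold)
  have int: "set_integrable lebesgue A f" if "A \<in> sets lebesgue" for A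
    unfolding set_integrable_def using f that by (rule integrable_mult_indicator[rotated])
  have borel0: "(LINT t:A|lebesgue. f t) = 0" if "A \<in> sets borel" for A
  proof -
    have stable: "Int_stable (range (\<lambda>(a, b). {a<..<b::real}))"
    proof (rule Int_stableI, clarify)
      fix a b c d :: real
      have "{a<..<b} \<inter> {c<..<d} = {max a c<..<min b d}" by auto
      then show "{a<..<b} \<inter> {c<..<d} \<in> range (\<lambda>(a, b). {a<..<b})" by auto
    qed
    have "A \<in> sigma_sets UNIV (range (\<lambda>(a, b). {a<..<b::real}))"
      using that sets_borel by simp
    with stable subset_UNIV[of "range (\<lambda>(a, b). {a<..<b::real})", folded Pow_UNIV] show ?thesis
    proof (induction rule: sigma_sets_induct_disjoint)
      case (basic A)
      then show ?case using zero by auto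
    next
      case empty
      then show ?case by (simp add: set_lebesgue_integral_def)
    next
      case (compl A)
      then have "A \<in> sets lebesgue"
        unfolding sets_borel[symmetric] by (intro sets_completionI_sets) simp
      then have "(LINT t:A \<union> (UNIV - A)|lebesgue. f t) = (LINT t:A|lebesgue. f t) + (LINT t:UNIV - A|lebesgue. f t)"
        by (intro set_integral_Un int) auto
      then show ?case
        using compl UNIV_zero by (simp add: set_lebesgue_integral_def)
    next
      case (union A)
      then have "A i \<in> sets lebesgue" for i
        unfolding sets_borel[symmetric] by (intro sets_completionI_sets) auto
      then have "(LINT t:(\<Union>i. A i)|lebesgue. f t) = (\<Sum>i. (LINT t:A i|lebesgue. f t))"
        using union by (intro lebesgue_integral_countable_add int) (auto simp: disjoint_family_on_def)
      then show ?case
        using union by simp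
    qed
  qed
  show ?thesis
  proof (rule density_zero[OF f])
    fix A :: "real set" assume A: "A \<in> sets lebesgue"
    \<comment> \<open>A Lebesgue set differs from its Borel main part only by a subset of a null
      set, which the integral does not see.\<close>
    have "(LINT t:A|lebesgue. f t) = (LINT t:main_part lborel A|lebesgue. f t)"
      unfolding set_lebesgue_integral_def
    proof (rule integral_cong_AE)
      obtain N where "N \<in> null_sets lborel" "null_part lborel A \<subseteq> N"
        using null_part[OF A] by blast
      then have "AE t in lebesgue. t \<notin> null_part lborel A"
        by (intro AE_completion AE_I'[of N]) auto
      then show "AE t in lebesgue. indicat_real A t *\<^sub>R f t = indicat_real (main_part lborel A) t *\<^sub>R f t"
        by eventually_elim (use main_part_null_part_Un[OF A] in \<open>auto simp: indicator_def\<close>)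
    qed (use int[unfolded set_integrable_def] A main_part_sets[OF A] in \<open>auto intro: borel_measurable_integrable sets_completionI_sets\<close>)
    also have "\<dots> = 0"
      using main_part_sets[OF A] by (intro borel0) simp
    finally show "(LINT t:A|lebesgue. f t) = 0" .
  qed
qed

text \<open>The function \<open>q n\<close> is nonnegative and positive exactly on the part of
  \<open>(a,b)\<close> at distance more than \<open>1 / real (Suc n)\<close> from both
  \<open>0\<close> and \<open>T\<close>; this retreat keeps the support of \<open>\<phi> n\<close>
  inside \<open>(0,T)\<close>. At a point of the target set \<open>q n\<close> tends to a positive
  limit, so \<open>real n * q n t\<close> tends to infinity and
  \<open>1 - exp (- (real n * q n t))\<close> to 1. Elsewhere \<open>q n\<close> is identically
  0.\<close>

lemma test_function_approx_interval:
  assumes "0 < T"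
  obtains \<phi> :: "nat \<Rightarrow> real \<Rightarrow> real"
  where "\<And>n. test_function T (\<phi> n)" "\<And>n t. \<bar>\<phi> n t\<bar> \<le> 1"
    "\<And>t. (\<lambda>n. \<phi> n t) \<longlonglongrightarrow> indicat_real ({a<..<b} \<inter> {0<..<T}) t"
proof -
  define q where "q n t = pos_sq (t - a) * pos_sq (b - t) * (pos_sq (t - 1 / real (Suc n)) * pos_sq (T - 1 / real (Suc n) - t))" for n t
  define \<phi> where "\<phi> n t = 1 - exp (- (real n * q n t))" for n t
  show ?thesis
  proof (rule that[of \<phi>])
    fix n t
    have q0: "0 \<le> q n t" for t by (simp add: q_def)
    then show "\<bar>\<phi> n t\<bar> \<le> 1" by (simp add: \<phi>_def)
    have "\<phi> n C1_differentiable_on UNIV"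
      unfolding \<phi>_def[abs_def] q_def
      by (rule C1_differentiable_on_UNIV_I)
        (rule derivative_eq_intros refl | rule continuous_intros)+
    moreover have "closure {t. \<phi> n t \<noteq> 0} \<subseteq> {1 / real (Suc n) .. T - 1 / real (Suc n)}"
    proof (rule closure_minimal)
      show "{t. \<phi> n t \<noteq> 0} \<subseteq> {1 / real (Suc n) .. T - 1 / real (Suc n)}"
      proof
        fix t assume "t \<in> {t. \<phi> n t \<noteq> 0}"
        then have "q n t \<noteq> 0"
          unfolding \<phi>_def by force
        then show "t \<in> {1 / real (Suc n) .. T - 1 / real (Suc n)}"
          unfolding q_def mult_eq_0_iff pos_sq_eq_0_iff atLeastAtMost_iff by linarith
      qed
    qed auto
    moreover have "{e .. T - e} \<subseteq> {0<..<T}" if "0 < e" for e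
      using that by auto
    then have "{1 / real (Suc n) .. T - 1 / real (Suc n)} \<subseteq> {0<..<T}"
      by simp
    ultimately show "test_function T (\<phi> n)"
      unfolding test_function_def by blast
  next
    fix t
    show "(\<lambda>n. \<phi> n t) \<longlonglongrightarrow> indicat_real ({a<..<b} \<inter> {0<..<T}) t"
    proof (cases "t \<in> {a<..<b} \<inter> {0<..<T}")
      case True
      define l where "l = pos_sq (t - a) * pos_sq (b - t) * (pos_sq t * pos_sq (T - t))"
      have lim1: "(\<lambda>n. 1 / real (Suc n)) \<longlonglongrightarrow> 0"
        using LIMSEQ_inverse_real_of_nat by (simp add: inverse_eq_divide)
      have cont: "isCont pos_sq x" for x
        using pos_sq_has_derivative DERIV_isCont by blast
      have "(\<lambda>n. q n t) \<longlonglongrightarrow> pos_sq (t - a) * pos_sq (b - t) * (pos_sq (t - 0) * pos_sq (T - 0 - t))"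
        unfolding q_def by (intro tendsto_intros isCont_tendsto_compose[OF cont] lim1)
      then have "(\<lambda>n. q n t) \<longlonglongrightarrow> l" by (simp add: l_def)
      moreover have "l > 0"
        using True unfolding l_def by (intro mult_pos_pos) auto
      ultimately have "filterlim (\<lambda>n. q n t * real n) at_top sequentially"
        by (intro filterlim_tendsto_pos_mult_at_top filterlim_real_sequentially)
      then have "filterlim (\<lambda>n. - (real n * q n t)) at_bot sequentially"
        by (simp add: filterlim_uminus_at_top mult.commute)
      then have "(\<lambda>n. exp (- (real n * q n t))) \<longlonglongrightarrow> 0"
        by (rule filterlim_compose[OF exp_at_bot])
      then have "(\<lambda>n. 1 - exp (- (real n * q n t))) \<longlonglongrightarrow> 1 - 0"
        by (intro tendsto_intros)
      then show ?thesis
        using True by (simp add: \<phi>_def)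
    next
      case False
      have "\<phi> n t = 0" for n
      proof -
        have "0 < 1 / real (Suc n)" by simp
        moreover have "t \<le> a \<or> b \<le> t \<or> t \<le> 0 \<or> T \<le> t"
          using False by (simp only: Int_iff greaterThanLessThan_iff) linarith
        ultimately have "q n t = 0"
          unfolding q_def mult_eq_0_iff pos_sq_eq_0_iff by linarith
        then show ?thesis by (simp add: \<phi>_def)
      qed
      with False show ?thesis by simp
    qed
  qed
qed

text \<open>Extend \<open>d\<close> by zero to the line. Test functions bounded by 1 converge
  pointwise to the indicator of an interval within \<open>(0,T)\<close>, so dominated convergence
  turns orthogonality into vanishing integrals over all open intervals.\<close>

lemma AE_zero_if_orthogonal_to_test_functions:
  fixes d :: "real \<Rightarrow> 'a::euclidean_space"
  assumes d: "d absolutely_integrable_on {0<..<T}" and T: "0 < T"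
    and orth: "\<And>\<phi>. test_function T \<phi> \<Longrightarrow> (LINT t:{0<..<T}|lebesgue. \<phi> t *\<^sub>R d t) = 0"
  shows "AE t in lebesgue. t \<in> {0<..<T} \<longrightarrow> d t = 0"
proof -
  define f where "f t = indicat_real {0<..<T} t *\<^sub>R d t" for t
  have f: "integrable lebesgue f"
    using d by (simp add: f_def[abs_def] set_integrable_def)
  have zero: "(LINT t:{a<..<b}|lebesgue. f t) = 0" for a b
  proof -
    obtain \<phi> :: "nat \<Rightarrow> real \<Rightarrow> real" where \<phi>: "\<And>n. test_function T (\<phi> n)" "\<And>n t. \<bar>\<phi> n t\<bar> \<le> 1"
      "\<And>t. (\<lambda>n. \<phi> n t) \<longlonglongrightarrow> indicat_real ({a<..<b} \<inter> {0<..<T}) t"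
      using test_function_approx_interval[OF T] by blast
    have "(\<lambda>n. LINT t|lebesgue. \<phi> n t *\<^sub>R f t) \<longlonglongrightarrow> (LINT t|lebesgue. indicat_real {a<..<b} t *\<^sub>R f t)"
    proof (rule integral_dominated_convergence[where w="\<lambda>t. norm (f t)"])
      show "(\<lambda>t. indicat_real {a<..<b} t *\<^sub>R f t) \<in> borel_measurable lebesgue"
        using f by (intro borel_measurable_scaleR borel_measurable_indicator) auto
      fix n
      have "\<phi> n \<in> borel_measurable lborel"
        using borel_measurable_continuous_onI[OF C1_differentiable_on_UNIV_D(3)[OF test_functionD(1)[OF \<phi>(1)]]] by simp
      then have "\<phi> n \<in> borel_measurable lebesgue" by (rule measurable_completion)
      then show "(\<lambda>t. \<phi> n t *\<^sub>R f t) \<in> borel_measurable lebesgue"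
        using f by (intro borel_measurable_scaleR) auto
      show "AE t in lebesgue. norm (\<phi> n t *\<^sub>R f t) \<le> norm (f t)"
        using \<phi>(2) by (auto intro!: AE_I2 mult_left_le_one_le)
    next
      show "AE t in lebesgue. (\<lambda>n. \<phi> n t *\<^sub>R f t) \<longlonglongrightarrow> indicat_real {a<..<b} t *\<^sub>R f t"
      proof (rule AE_I2)
        fix t
        have "(\<lambda>n. \<phi> n t *\<^sub>R f t) \<longlonglongrightarrow> indicat_real ({a<..<b} \<inter> {0<..<T}) t *\<^sub>R f t"
          by (intro tendsto_intros \<phi>)
        then show "(\<lambda>n. \<phi> n t *\<^sub>R f t) \<longlonglongrightarrow> indicat_real {a<..<b} t *\<^sub>R f t"
          by (auto simp: f_def indicator_def split: if_splits)
      qed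
    qed (use f in auto)
    moreover have "(LINT t|lebesgue. \<phi> n t *\<^sub>R f t) = 0" for n
      using orth[OF \<phi>(1)[of n]] by (simp add: set_lebesgue_integral_def f_def mult.commute)
    ultimately show ?thesis
      by (simp add: LIMSEQ_const_iff set_lebesgue_integral_def)
  qed
  have "(LINT t|lebesgue. f t) = (LINT t:{0<..<T}|lebesgue. f t)"
    unfolding set_lebesgue_integral_def f_def
    by (intro Bochner_Integration.integral_cong) (auto simp: indicator_def)
  with zero have "AE t in lebesgue. f t = 0"
    by (intro AE_zero_if_interval_integrals_zero f) auto
  then show ?thesis
    by eventually_elim (auto simp: f_def)
qed

lemma weak_deriv_unique:
  fixes g h :: "real \<Rightarrow> 'a::euclidean_space"
  assumes "L2_on {0<..<T} g" "L2_on {0<..<T} h" "has_weak_deriv T f g" "has_weak_deriv T f h" "0 < T"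
  shows "AE t in lebesgue. t \<in> {0<..<T} \<longrightarrow> g t = h t"
proof -
  have g: "g absolutely_integrable_on {0<..<T}" and h: "h absolutely_integrable_on {0<..<T}"
    using assms by (auto intro: L2_on_imp_absolutely_integrable)
  have "AE t in lebesgue. t \<in> {0<..<T} \<longrightarrow> g t - h t = 0"
  proof (rule AE_zero_if_orthogonal_to_test_functions)
    fix \<phi> assume tf: "test_function T \<phi>"
    note \<phi> = C1_differentiable_on_UNIV_D[OF test_functionD(1)[OF tf]]
    have "(LINT t:{0<..<T}|lebesgue. \<phi> t *\<^sub>R g t) = (LINT t:{0<..<T}|lebesgue. \<phi> t *\<^sub>R h t)"
      using assms(3)[unfolded has_weak_deriv_def, rule_format, OF tf]
        assms(4)[unfolded has_weak_deriv_def, rule_format, OF tf] by simp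
    then show "(LINT t:{0<..<T}|lebesgue. \<phi> t *\<^sub>R (g t - h t)) = 0"
      unfolding scaleR_diff_right
      by (subst set_integral_diff(2)) (auto intro!: absolutely_integrable_continuous_mult g h \<phi>)
  qed (use g h assms in auto)
  then show ?thesis by eventually_elim auto
qed

text \<open>\<open>weak_deriv\<close> is a choice operator, so its values are inaccessible directly.
  Almost everywhere uniqueness allows the norm to be computed with any explicitly known weak
  derivative.\<close>

lemma H1_norm_sq_eq:
  fixes f g :: "real \<Rightarrow> 'a::euclidean_space"
  assumes f: "L2_on {0<..<T} f" and g: "L2_on {0<..<T} g" "has_weak_deriv T f g" and "0 < T"
  shows "f \<in> H1 T" "H1_norm_sq T f = L2_norm_sq {0<..<T} f + L2_norm_sq {0<..<T} g"
proof -
  show "f \<in> H1 T"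
    using f g by (auto simp: H1_def)
  define h where "h = weak_deriv T f"
  have h: "L2_on {0<..<T} h \<and> has_weak_deriv T f h"
    unfolding h_def weak_deriv_def by (rule someI[of _ g]) (use g in auto)
  then have "AE t in lebesgue. t \<in> {0<..<T} \<longrightarrow> h t = g t"
    using g assms(4) weak_deriv_unique by blast
  then have ae: "AE t in lebesgue. indicat_real {0<..<T} t *\<^sub>R (norm (h t))\<^sup>2
      = indicat_real {0<..<T} t *\<^sub>R (norm (g t))\<^sup>2"
    by eventually_elim (auto simp: indicator_def)
  have "L2_norm_sq {0<..<T} h = L2_norm_sq {0<..<T} g"
    unfolding L2_norm_sq_def set_lebesgue_integral_def
    using h g ae by (intro integral_cong_AE) (auto simp: L2_on_def set_integrable_def)
  then show "H1_norm_sq T f = L2_norm_sq {0<..<T} f + L2_norm_sq {0<..<T} g"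
    by (simp add: H1_norm_sq_def h_def)
qed

section \<open>Caratheodory solutions and the ReLU system\<close>

text \<open>The integral formulation of \<open>relu_solution\<close>, freed from the ReLU field and
  from starting time 0, so that solutions can be cut and glued at intermediate times.\<close>

definition ivp_solution ::
    "(real \<Rightarrow> 'a \<Rightarrow> 'a) \<Rightarrow> real \<Rightarrow> real \<Rightarrow> 'a::euclidean_space \<Rightarrow> (real \<Rightarrow> 'a) \<Rightarrow> bool" where
  "ivp_solution F a b x0 x \<longleftrightarrow>
     continuous_on {a..b} x \<and> (\<forall>t\<in>{a..b}. ((\<lambda>s. F s (x s)) has_integral (x t - x0)) {a..t})"

definition relu_field :: "(real \<Rightarrow> ('d::finite) params) \<Rightarrow> real \<Rightarrow> real ^ 'd \<Rightarrow> real ^ 'd" where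
  "relu_field u s v = relu (fst (u s) *v v + snd (u s))"

lemma relu_solution_iff_ivp: "relu_solution T u x0 x \<longleftrightarrow> ivp_solution (relu_field u) 0 T x0 x"
  by (simp add: relu_solution_def ivp_solution_def relu_field_def)

lemma ivp_solution_initial:
  assumes "ivp_solution F a b x0 x" "a \<le> b"
  shows "x a = x0"
proof -
  have "((\<lambda>s. F s (x s)) has_integral (x a - x0)) {a..a}"
    using assms unfolding ivp_solution_def by (meson atLeastAtMost_iff order_refl)
  moreover have "((\<lambda>s. F s (x s)) has_integral 0) {a..a}"
    using has_integral_refl(2)[of "\<lambda>s. F s (x s)" a] by simp
  ultimately have "x a - x0 = 0"
    by (rule has_integral_unique)
  then show ?thesis by simp
qed

lemma ivp_solution_increment:
  assumes x: "ivp_solution F a b x0 x" and "a \<le> c" "c \<le> t" "t \<le> b"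
  shows "((\<lambda>s. F s (x s)) has_integral (x t - x c)) {c..t}"
proof -
  have t: "((\<lambda>s. F s (x s)) has_integral (x t - x0)) {a..t}" and c: "((\<lambda>s. F s (x s)) has_integral (x c - x0)) {a..c}"
    using assms by (auto simp: ivp_solution_def)
  have int: "(\<lambda>s. F s (x s)) integrable_on {a..t}"
    using t by blast
  then have "(\<lambda>s. F s (x s)) integrable_on {c..t}"
    by (rule integrable_subinterval_real) (use assms in auto)
  moreover have "integral {a..c} (\<lambda>s. F s (x s)) + integral {c..t} (\<lambda>s. F s (x s)) = integral {a..t} (\<lambda>s. F s (x s))"
    by (rule Henstock_Kurzweil_Integration.integral_combine) (use assms int in auto)
  then have "integral {c..t} (\<lambda>s. F s (x s)) = x t - x c"
    using integral_unique[OF t] integral_unique[OF c] by (simp add: algebra_simps)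
  ultimately show ?thesis
    using integrable_integral by fastforce
qed

lemma ivp_solution_restrict:
  "ivp_solution F a b x0 x \<Longrightarrow> c \<le> b \<Longrightarrow> ivp_solution F a c x0 x"
  by (auto simp: ivp_solution_def intro: continuous_on_subset)

lemma ivp_solution_cong:
  assumes "ivp_solution F a b x0 x" "\<And>s v. s \<in> {a..b} \<Longrightarrow> F s v = G s v"
    "\<And>s. s \<in> {a..b} \<Longrightarrow> x s = y s"
  shows "ivp_solution G a b x0 y"
  unfolding ivp_solution_def
proof (intro conjI ballI)
  show "continuous_on {a..b} y"
    using assms by (metis (full_types) continuous_on_cong ivp_solution_def)
  fix t assume t: "t \<in> {a..b}"
  then have "((\<lambda>s. F s (x s)) has_integral (y t - x0)) {a..t}"
    using assms by (auto simp: ivp_solution_def)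
  then show "((\<lambda>s. G s (y s)) has_integral (y t - x0)) {a..t}"
    by (rule has_integral_eq[rotated]) (use assms t in auto)
qed

lemma ivp_solution_concat:
  assumes x: "ivp_solution F a b x0 x" and y: "ivp_solution F b c (x b) y" and ab: "a \<le> b" "b \<le> c"
  shows "ivp_solution F a c x0 (\<lambda>t. if t \<le> b then x t else y t)" (is "ivp_solution _ _ _ _ ?z")
proof -
  have yb: "y b = x b"
    using ivp_solution_initial[OF y ab(2)] .
  have x': "ivp_solution F a b x0 ?z"
    by (rule ivp_solution_cong[OF x]) auto
  have y': "ivp_solution F b c (x b) ?z"
    by (rule ivp_solution_cong[OF y]) (use yb in auto)
  have "continuous_on ({a..b} \<union> {b..c}) ?z"
    by (rule continuous_on_closed_Un) (use x' y' in \<open>auto simp: ivp_solution_def\<close>)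
  moreover have "{a..b} \<union> {b..c} = {a..c}"
    using ab by auto
  moreover have "((\<lambda>s. F s (?z s)) has_integral (?z t - x0)) {a..t}" if t: "t \<in> {a..c}" for t
  proof (cases "t \<le> b")
    case True
    then show ?thesis
      using x' t by (auto simp: ivp_solution_def)
  next
    case False
    have "((\<lambda>s. F s (?z s)) has_integral (x b - x0)) {a..b}"
      using x' ab by (auto simp: ivp_solution_def)
    moreover have "((\<lambda>s. F s (?z s)) has_integral (?z t - x b)) {b..t}"
      using y' t False unfolding ivp_solution_def by (meson atLeastAtMost_iff linear)
    ultimately have "((\<lambda>s. F s (?z s)) has_integral ((x b - x0) + (?z t - x b))) {a..t}"
      using False ab by (intro has_integral_combine) auto
    then show ?thesis by simp
  qed
  ultimately show ?thesis
    unfolding ivp_solution_def by metis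
qed

text \<open>Let \<open>M\<close> be the largest distance between the two solutions on
  \<open>{c..d}\<close>. They agree at \<open>c\<close>, so integrating the Lipschitz bound up to a
  maximiser gives \<open>M \<le> 1/2 * M\<close>.\<close>

lemma ivp_solution_unique_short:
  fixes x y :: "real \<Rightarrow> 'a::euclidean_space"
  assumes x: "ivp_solution F a b x0 x" and y: "ivp_solution F a b x0 y"
    and cd: "a \<le> c" "c \<le> d" "d \<le> b" and eq: "x c = y c"
    and L: "L integrable_on {c..d}" "\<And>s. 0 \<le> L s" "integral {c..d} L \<le> 1/2"
    and lip: "\<And>s v w. norm (F s v - F s w) \<le> L s * norm (v - w)"
    and t: "t \<in> {c..d}"
  shows "x t = y t"
proof -
  have "continuous_on {c..d} (\<lambda>t. norm (x t - y t))"
    using x y cd by (auto simp: ivp_solution_def intro!: continuous_intros intro: continuous_on_subset)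
  then obtain m where m: "m \<in> {c..d}" "\<And>s. s \<in> {c..d} \<Longrightarrow> norm (x s - y s) \<le> norm (x m - y m)"
    using continuous_attains_sup[of "{c..d}" "\<lambda>t. norm (x t - y t)"] cd by auto
  define M where "M = norm (x m - y m)"
  have hi: "((\<lambda>s. F s (x s) - F s (y s)) has_integral ((x m - x c) - (y m - y c))) {c..m}"
    using m cd by (intro has_integral_diff ivp_solution_increment[OF x] ivp_solution_increment[OF y]) auto
  have Lm: "L integrable_on {c..m}"
    by (rule integrable_subinterval_real[OF L(1)]) (use m in auto)
  have "norm (integral {c..m} (\<lambda>s. F s (x s) - F s (y s))) \<le> integral {c..m} (\<lambda>s. L s * M)"
  proof (rule integral_norm_bound_integral)
    fix s assume s: "s \<in> {c..m}"
    have "norm (F s (x s) - F s (y s)) \<le> L s * norm (x s - y s)" by (rule lip)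
    also have "\<dots> \<le> L s * M"
      using s m L(2) by (intro mult_left_mono) (auto simp: M_def)
    finally show "norm (F s (x s) - F s (y s)) \<le> L s * M" .
  qed (use hi Lm in \<open>auto intro: integrable_on_mult_left\<close>)
  also have "\<dots> = integral {c..m} L * M"
    by (simp add: integral_mult_left)
  also have "\<dots> \<le> integral {c..d} L * M"
    using m Lm L by (intro mult_right_mono integral_subset_le) (auto simp: M_def)
  also have "\<dots> \<le> 1/2 * M"
    using L by (intro mult_right_mono) (auto simp: M_def)
  finally have "M \<le> 1/2 * M"
    using integral_unique[OF hi] eq by (simp add: M_def)
  then have "M \<le> 0" by simp
  then show ?thesis
    using m(2)[OF t] by (simp add: M_def)
qed

text \<open>The Lipschitz rate \<open>L\<close> is only integrable, but its primitive is uniformly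
  continuous. Hence all sufficiently short intervals carry integral at most 1/2, and the short-time
  result propagates equality step by step.\<close>

lemma ivp_solution_unique:
  fixes x y :: "real \<Rightarrow> 'a::euclidean_space"
  assumes x: "ivp_solution F a b x0 x" and y: "ivp_solution F a b x0 y" and ab: "a \<le> b"
    and L: "L integrable_on {a..b}" "\<And>s. 0 \<le> L s"
    and lip: "\<And>s v w. norm (F s v - F s w) \<le> L s * norm (v - w)"
    and t: "t \<in> {a..b}"
  shows "x t = y t"
proof -
  have "uniformly_continuous_on {a..b} (\<lambda>t. integral {a..t} L)"
    by (intro compact_uniformly_continuous indefinite_integral_continuous_1 L) auto
  then obtain \<delta> where \<delta>: "\<delta> > 0" "\<And>s t. s \<in> {a..b} \<Longrightarrow> t \<in> {a..b} \<Longrightarrow> dist t s < \<delta> \<Longrightarrow>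
      dist (integral {a..t} L) (integral {a..s} L) < 1/2"
    unfolding uniformly_continuous_on_def by (metis half_gt_zero_iff zero_less_one)
  have "\<forall>t\<in>{a..b}. t \<le> a + real n * (\<delta> / 2) \<longrightarrow> x t = y t" for n
  proof (induction n)
    case 0
    then show ?case
      using ivp_solution_initial[OF x ab] ivp_solution_initial[OF y ab] by auto
  next
    case (Suc n)
    show ?case
    proof (intro ballI impI)
      fix t assume t: "t \<in> {a..b}" "t \<le> a + real (Suc n) * (\<delta> / 2)"
      \<comment> \<open>\<open>c\<close> is the end of the stretch covered by the induction
        hypothesis, cut at \<open>t\<close>. Steps of half of \<open>\<delta>\<close> keep
        \<open>t - c\<close> strictly below \<open>\<delta>\<close>.\<close>
      define c where "c = min t (a + real n * (\<delta> / 2))"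
      have c: "c \<in> {a..b}" "c \<le> t" "t - c < \<delta>"
        using t \<delta>(1) by (auto simp: c_def min_def field_simps)
      have Lt: "L integrable_on {a..t}"
        by (rule integrable_subinterval_real[OF L(1)]) (use t in auto)
      have "integral {c..t} L = integral {a..t} L - integral {a..c} L"
        using Henstock_Kurzweil_Integration.integral_combine[of a c t L] c Lt by auto
      also have "\<dots> \<le> 1/2"
      proof -
        have "dist t c < \<delta>"
          using c by (simp add: dist_real_def)
        then have "dist (integral {a..t} L) (integral {a..c} L) < 1/2"
          by (rule \<delta>(2)[OF c(1) t(1)])
        then show ?thesis
          unfolding dist_real_def by linarith
      qed
      finally have half: "integral {c..t} L \<le> 1/2" .
      show "x t = y t"
      proof (rule ivp_solution_unique_short[OF x y _ _ _ _ _ L(2) half lip])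
        show "x c = y c"
          using Suc c by (auto simp: c_def)
        show "L integrable_on {c..t}"
          by (rule integrable_subinterval_real[OF Lt]) (use c in auto)
      qed (use c t in auto)
    qed
  qed
  moreover obtain n where "(t - a) / (\<delta> / 2) \<le> real n"
    using real_arch_simple by blast
  then have "t \<le> a + real n * (\<delta> / 2)"
    using \<delta>(1) by (simp add: field_simps)
  ultimately show ?thesis using t by blast
qed

text \<open>Picard iteration: under the bound 1/2 on the integral of \<open>L\<close>, the integral
  operator contracts the sup distance by 1/2, and the Banach fixed point theorem applies.\<close>

lemma ivp_solution_exists_short:
  fixes x0 :: "'a::euclidean_space"
  assumes ab: "a \<le> b"
    and L: "L integrable_on {a..b}" "\<And>s. 0 \<le> L s" "integral {a..b} L \<le> 1/2"
    and lip: "\<And>s v w. norm (F s v - F s w) \<le> L s * norm (v - w)"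
    and int: "\<And>f. continuous_on {a..b} f \<Longrightarrow> (\<lambda>s. F s (f s)) integrable_on {a..b}"
  obtains x where "ivp_solution F a b x0 x"
proof -
  define I where "I g t = x0 + integral {a..t} (\<lambda>s. F s (apply_bcontfun g s))" for g :: "real \<Rightarrow>\<^sub>C 'a" and t
  have int': "(\<lambda>s. F s (apply_bcontfun g s)) integrable_on {a..b}" for g :: "real \<Rightarrow>\<^sub>C 'a"
    by (rule int) simp
  \<comment> \<open>Bounded continuous functions live on the whole line, so the Picard image is
    continued constantly outside \<open>{a..b}\<close> by \<open>clamp\<close>.\<close>
  have "\<exists>h :: real \<Rightarrow>\<^sub>C 'a. (\<forall>t\<in>{a..b}. h t = I g t) \<and> (\<forall>t. h t = I g (clamp a b t))" for g :: "real \<Rightarrow>\<^sub>C 'a"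
  proof -
    have "continuous_on (cbox a b) (I g)"
      unfolding I_def[abs_def] by (auto intro!: continuous_intros indefinite_integral_continuous_1 int')
    then obtain h :: "real \<Rightarrow>\<^sub>C 'a" where
      "\<And>t. t \<in> cbox a b \<Longrightarrow> h t = I g t" "\<And>t. h t = I g (clamp a b t)"
      using continuous_on_cbox_bcontfunE by blast
    then show ?thesis
      unfolding cbox_interval by blast
  qed
  then obtain \<Phi> :: "(real \<Rightarrow>\<^sub>C 'a) \<Rightarrow> (real \<Rightarrow>\<^sub>C 'a)"
    where \<Phi>: "\<And>g t. t \<in> {a..b} \<Longrightarrow> \<Phi> g t = I g t" "\<And>g t. \<Phi> g t = I g (clamp a b t)"
    by metis
  have "dist (\<Phi> g) (\<Phi> h) \<le> 1/2 * dist g h" for g h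
  proof (rule dist_bound)
    fix t
    define c where "c = clamp a b t"
    have c: "c \<in> {a..b}"
      using clamp_in_interval[of a b t] ab by (simp add: c_def)
    have sub: "k integrable_on {a..c}" if "k integrable_on {a..b}" for k :: "real \<Rightarrow> 'b::banach"
      by (rule integrable_subinterval_real[OF that]) (use c in auto)
    have "dist (\<Phi> g t) (\<Phi> h t) = norm (integral {a..c} (\<lambda>s. F s (g s) - F s (h s)))"
      using sub[OF int'] by (simp add: \<Phi>(2) I_def dist_norm integral_diff flip: c_def)
    also have "\<dots> \<le> integral {a..c} (\<lambda>s. L s * dist g h)"
    proof (rule integral_norm_bound_integral)
      fix s assume s: "s \<in> {a..c}"
      have "norm (F s (g s) - F s (h s)) \<le> L s * norm (g s - h s)" by (rule lip)
      also have "\<dots> \<le> L s * dist g h"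
        using L(2) dist_bounded[of g s h] by (intro mult_left_mono) (auto simp: dist_norm)
      finally show "norm (F s (g s) - F s (h s)) \<le> L s * dist g h" .
    qed (auto intro!: integrable_diff sub int' integrable_on_mult_left L)
    also have "\<dots> = integral {a..c} L * dist g h"
      by (simp add: integral_mult_left)
    also have "\<dots> \<le> integral {a..b} L * dist g h"
      using c L sub[OF L(1)] by (intro mult_right_mono integral_subset_le) auto
    also have "\<dots> \<le> 1/2 * dist g h"
      using L by (intro mult_right_mono) auto
    finally show "dist (\<Phi> g t) (\<Phi> h t) \<le> 1/2 * dist g h" .
  qed
  then have "\<exists>!x. \<Phi> x = x"
    by (intro banach_fix_type[of "1/2"]) auto
  then obtain g where g: "\<Phi> g = g" by blast
  have "ivp_solution F a b x0 g"
    unfolding ivp_solution_def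
  proof (intro conjI ballI)
    fix t assume t: "t \<in> {a..b}"
    have "g t - x0 = integral {a..t} (\<lambda>s. F s (g s))"
      using \<Phi>(1)[OF t, of g] by (simp add: g I_def)
    moreover have "(\<lambda>s. F s (g s)) integrable_on {a..t}"
      by (rule integrable_subinterval_real[OF int']) (use t in auto)
    ultimately show "((\<lambda>s. F s (g s)) has_integral (g t - x0)) {a..t}"
      using integrable_integral by fastforce
  qed simp
  then show thesis by (rule that)
qed

section \<open>Estimates and special solutions for the ReLU system\<close>

lemma norm_relu_diff_le: "norm (relu v - relu w) \<le> norm (v - w)"
  unfolding norm_vec_def
  by (rule L2_set_mono) (auto simp: relu_def max_def abs_if)

lemma norm_relu_le: "norm (relu v) \<le> norm (v :: real ^ 'd)"
proof -
  have "relu 0 = (0 :: real ^ 'd)" by (simp add: relu_def vec_eq_iff)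
  then show ?thesis
    using norm_relu_diff_le[of v 0] by simp
qed

lemma relu_nonneg: "0 \<le> relu v $ k"
  by (simp add: relu_def)

lemma norm_matrix_vector_mult_le:
  fixes A :: "real ^ 'n ^ 'm"
  shows "norm (A *v x) \<le> norm A * norm x"
proof -
  have "norm (A *v x) \<le> L2_set (\<lambda>i. norm (A $ i) * norm x) UNIV"
    unfolding norm_vec_def[of "A *v x"]
    by (rule L2_set_mono) (auto simp: matrix_vector_mul_component Cauchy_Schwarz_ineq2)
  also have "\<dots> = norm A * norm x"
    by (simp add: norm_vec_def[of A] L2_set_left_distrib)
  finally show ?thesis .
qed

text \<open>The ReLU is 1-Lipschitz, so \<open>norm (u s)\<close> can serve as the integrable
  Lipschitz rate in the existence and uniqueness results.\<close>

lemma relu_field_lipschitz: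
  "norm (relu_field u s v - relu_field u s w) \<le> norm (u s) * norm (v - w)"
proof -
  have "norm (relu_field u s v - relu_field u s w) \<le> norm (fst (u s) *v (v - w))"
    unfolding relu_field_def
    by (rule order_trans[OF norm_relu_diff_le]) (simp add: matrix_vector_mult_diff_distrib)
  also have "\<dots> \<le> norm (fst (u s)) * norm (v - w)"
    by (rule norm_matrix_vector_mult_le)
  also have "\<dots> \<le> norm (u s) * norm (v - w)"
    using norm_fst_le[of "fst (u s)" "snd (u s)"] by (intro mult_right_mono) auto
  finally show ?thesis .
qed

lemma norm_relu_field_le: "norm (relu_field u s v) \<le> norm (u s) * (norm v + 1)"
proof -
  have "norm (relu_field u s v) \<le> norm (fst (u s) *v v) + norm (snd (u s))"
    unfolding relu_field_def by (rule order_trans[OF norm_relu_le norm_triangle_ineq])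
  also have "\<dots> \<le> norm (fst (u s)) * norm v + norm (snd (u s))"
    using norm_matrix_vector_mult_le by (rule add_right_mono)
  also have "\<dots> \<le> norm (u s) * norm v + norm (u s)"
    using norm_fst_le[of "fst (u s)" "snd (u s)"] norm_snd_le[of "snd (u s)" "fst (u s)"]
    by (intro add_mono mult_right_mono) auto
  finally show ?thesis by (simp add: distrib_left)
qed

text \<open>The affine argument of the ReLU is an integrable matrix times a bounded measurable
  vector plus an integrable bias. Composition with the continuous ReLU keeps measurability, and
  \<open>norm_relu_le\<close> makes the argument itself the dominant.\<close>

lemma relu_field_integrable:
  fixes u :: "real \<Rightarrow> ('d::finite) params"
  assumes u: "u absolutely_integrable_on {a..b}" and f: "continuous_on {a..b} f"
  shows "(\<lambda>s. relu_field u s (f s)) integrable_on {a..b}"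
proof -
  have w: "(fst \<circ> u) absolutely_integrable_on {a..b}" and b: "(snd \<circ> u) absolutely_integrable_on {a..b}"
    using u by (auto intro: absolutely_integrable_linear bounded_linear_fst bounded_linear_snd)
  have fm: "f \<in> borel_measurable (lebesgue_on {a..b})"
    by (rule continuous_imp_measurable_on_sets_lebesgue) (auto intro: f)
  have "bounded (f ` {a..b})"
    by (intro compact_imp_bounded compact_continuous_image f) auto
  moreover have "bilinear (\<lambda>(v :: real ^ 'd) (A :: real ^ 'd ^ 'd). A *v v)"
    unfolding bilinear_def
    by (auto intro!: linearI simp: matrix_vector_right_distrib matrix_vector_mult_add_rdistrib
        matrix_vector_mult_scaleR scaleR_matrix_vector_assoc[symmetric])
  ultimately have "(\<lambda>s. (fst \<circ> u) s *v f s) absolutely_integrable_on {a..b}"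
    by (intro absolutely_integrable_bounded_measurable_product[where h="\<lambda>v A. A *v v", OF _ fm _ _ w]) auto
  then have i: "(\<lambda>s. fst (u s) *v f s + snd (u s)) absolutely_integrable_on {a..b}"
    using set_integral_add(1)[OF _ b] by (simp add: o_def)
  then have "(\<lambda>s. fst (u s) *v f s + snd (u s)) \<in> borel_measurable (lebesgue_on {a..b})"
    by (intro borel_measurable_integrable absolutely_integrable_imp_integrable) auto
  moreover have "continuous_on UNIV (relu :: real ^ 'd \<Rightarrow> real ^ 'd)"
    unfolding relu_def[abs_def] by (intro continuous_intros)
  ultimately have m: "(\<lambda>s. relu (fst (u s) *v f s + snd (u s))) \<in> borel_measurable (lebesgue_on {a..b})"
    using measurable_compose[OF _ borel_measurable_continuous_onI] by blast
  have "(\<lambda>s. relu (fst (u s) *v f s + snd (u s))) absolutely_integrable_on {a..b}"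
    by (rule measurable_bounded_by_integrable_imp_absolutely_integrable[OF m _ _ norm_relu_le])
      (use i in \<open>auto simp: absolutely_integrable_on_def\<close>)
  then show ?thesis
    by (simp add: relu_field_def[abs_def] absolutely_integrable_on_def)
qed

text \<open>The velocity has nonnegative components, so no component of the state decreases. This is
  what allows the ReLU to act as the identity later.\<close>

lemma relu_solution_nonneg:
  assumes x: "ivp_solution (relu_field u) a b x0 x" and t: "t \<in> {a..b}" and x0: "0 \<le> x0 $ k"
  shows "0 \<le> x t $ k"
proof -
  have "((\<lambda>s. relu_field u s (x s)) has_integral (x t - x0)) {a..t}"
    using x t by (auto simp: ivp_solution_def)
  then have "0 \<le> (x t - x0) \<bullet> axis k 1"
    by (rule has_integral_component_nonneg[rotated]) (auto simp: relu_field_def inner_axis relu_nonneg)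
  with x0 show ?thesis
    by (simp add: inner_axis)
qed

text \<open>In place of a Gronwall argument, let \<open>K\<close> be the largest displacement. Since
  \<open>norm (y s) \<le> K + norm x0\<close>, integration gives
  \<open>K \<le> \<eta> * (K + norm x0 + 1)\<close>, and \<open>\<eta> \<le> 1/2\<close> absorbs the
  term with \<open>K\<close>.\<close>

lemma relu_solution_displacement_le:
  assumes y: "ivp_solution (relu_field u) a b x0 y" and ab: "a \<le> b"
    and u: "(\<lambda>s. norm (u s)) integrable_on {a..b}"
    and \<eta>: "integral {a..b} (\<lambda>s. norm (u s)) \<le> \<eta>" "\<eta> \<le> 1/2"
    and t: "t \<in> {a..b}"
  shows "norm (y t - x0) \<le> 2 * \<eta> * (norm x0 + 1)"
proof -
  have "continuous_on {a..b} (\<lambda>t. norm (y t - x0))"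
    using y by (auto simp: ivp_solution_def intro!: continuous_intros)
  then obtain m where m: "m \<in> {a..b}" "\<And>s. s \<in> {a..b} \<Longrightarrow> norm (y s - x0) \<le> norm (y m - x0)"
    using continuous_attains_sup[of "{a..b}" "\<lambda>t. norm (y t - x0)"] ab by auto
  define K where "K = norm (y m - x0)"
  have hi: "((\<lambda>s. relu_field u s (y s)) has_integral (y m - x0)) {a..m}"
    using y m by (auto simp: ivp_solution_def)
  have um: "(\<lambda>s. norm (u s)) integrable_on {a..m}"
    by (rule integrable_subinterval_real[OF u]) (use m in auto)
  have \<eta>0: "0 \<le> \<eta>"
    using Henstock_Kurzweil_Integration.integral_nonneg[OF u] \<eta> by auto
  have "norm (integral {a..m} (\<lambda>s. relu_field u s (y s))) \<le> integral {a..m} (\<lambda>s. norm (u s) * (K + norm x0 + 1))"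
  proof (rule integral_norm_bound_integral)
    fix s assume s: "s \<in> {a..m}"
    have "norm (y s) \<le> norm (y s - x0) + norm x0"
      using norm_triangle_ineq[of "y s - x0" x0] by simp
    also have "norm (y s - x0) \<le> K"
      using m s by (auto simp: K_def)
    finally have "norm (u s) * (norm (y s) + 1) \<le> norm (u s) * (K + norm x0 + 1)"
      by (intro mult_left_mono) auto
    then show "norm (relu_field u s (y s)) \<le> norm (u s) * (K + norm x0 + 1)"
      using norm_relu_field_le order_trans by blast
  qed (use hi um in \<open>auto intro: integrable_on_mult_left\<close>)
  also have "\<dots> = integral {a..m} (\<lambda>s. norm (u s)) * (K + norm x0 + 1)"
    by (simp add: integral_mult_left)
  also have "integral {a..m} (\<lambda>s. norm (u s)) \<le> \<eta>"
    using \<eta>(1) integral_subset_le[OF _ um u] m by fastforce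
  then have "integral {a..m} (\<lambda>s. norm (u s)) * (K + norm x0 + 1) \<le> \<eta> * (K + norm x0 + 1)"
    by (intro mult_right_mono) (auto simp: K_def)
  also have "\<dots> = \<eta> * K + \<eta> * (norm x0 + 1)"
    by (simp add: algebra_simps)
  also have "\<eta> * K \<le> 1/2 * K"
    using \<eta> by (intro mult_right_mono) (auto simp: K_def)
  finally have "K \<le> 1/2 * K + \<eta> * (norm x0 + 1)"
    using integral_unique[OF hi] by (simp add: K_def)
  then have "K \<le> 2 * \<eta> * (norm x0 + 1)" by simp
  with m(2)[OF t] show ?thesis by (simp add: K_def)
qed

text \<open>On nonnegative states a nonnegative multiple of the identity matrix makes the ReLU
  argument nonnegative, so the system becomes the linear equation \<open>x' = \<psi> x\<close> with
  explicit exponential solution.\<close>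

lemma relu_solution_exponential:
  fixes u :: "real \<Rightarrow> ('d::finite) params"
  assumes \<Psi>: "\<And>t. (\<Psi> has_real_derivative \<psi> t) (at t)" "\<Psi> a = 0" and \<psi>: "\<And>t. 0 \<le> \<psi> t"
    and u: "\<And>t. t \<in> {a..b} \<Longrightarrow> u t = \<psi> t *\<^sub>R (mat 1, 0)" and x0: "\<And>k. 0 \<le> x0 $ k"
  shows "ivp_solution (relu_field u) a b x0 (\<lambda>t. exp (\<Psi> t) *\<^sub>R x0)"
  unfolding ivp_solution_def
proof (intro conjI ballI)
  have "continuous_on {a..b} \<Psi>"
    using \<Psi>(1) by (meson DERIV_isCont continuous_at_imp_continuous_on)
  then show "continuous_on {a..b} (\<lambda>t. exp (\<Psi> t) *\<^sub>R x0)"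
    by (intro continuous_intros)
  fix t assume t: "t \<in> {a..b}"
  have "((\<lambda>s. (exp (\<Psi> s) * \<psi> s) *\<^sub>R x0) has_integral (exp (\<Psi> t) *\<^sub>R x0 - exp (\<Psi> a) *\<^sub>R x0)) {a..t}"
  proof (rule fundamental_theorem_of_calculus)
    fix s
    have "((\<lambda>s. exp (\<Psi> s)) has_real_derivative exp (\<Psi> s) * \<psi> s) (at s within {a..t})"
      using DERIV_fun_exp[OF \<Psi>(1)] by (rule has_field_derivative_at_within)
    then show "((\<lambda>s. exp (\<Psi> s) *\<^sub>R x0) has_vector_derivative (exp (\<Psi> s) * \<psi> s) *\<^sub>R x0) (at s within {a..t})"
      using has_vector_derivative_scaleR[OF _ has_vector_derivative_const[of x0]] by fastforce
  qed (use t in auto)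
  then have "((\<lambda>s. (exp (\<Psi> s) * \<psi> s) *\<^sub>R x0) has_integral (exp (\<Psi> t) *\<^sub>R x0 - x0)) {a..t}"
    by (simp add: \<Psi>(2))
  moreover have eq: "relu_field u s (exp (\<Psi> s) *\<^sub>R x0) = (exp (\<Psi> s) * \<psi> s) *\<^sub>R x0" if "s \<in> {a..t}" for s
  proof -
    have "relu_field u s (exp (\<Psi> s) *\<^sub>R x0) = relu ((exp (\<Psi> s) * \<psi> s) *\<^sub>R x0)"
      using that t by (simp add: relu_field_def u scaleR_matrix_vector_assoc[symmetric] mult.commute)
    also have "\<dots> = (exp (\<Psi> s) * \<psi> s) *\<^sub>R x0"
    proof -
      have "0 \<le> exp (\<Psi> s) * \<psi> s * x0 $ k" for k
        using \<psi> x0 by (intro mult_nonneg_nonneg) auto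
      then show ?thesis
        by (simp add: relu_def vec_eq_iff max_absorb1)
    qed
    finally show ?thesis .
  qed
  ultimately show "((\<lambda>s. relu_field u s (exp (\<Psi> s) *\<^sub>R x0)) has_integral (exp (\<Psi> t) *\<^sub>R x0 - x0)) {a..t}"
    by (subst has_integral_cong[OF eq]) auto
qed

text \<open>\<open>relu_trajectory\<close> is a choice among solutions; uniqueness identifies it
  with any solution exhibited by hand.\<close>

lemma relu_trajectory_eq:
  fixes u :: "real \<Rightarrow> ('d::finite) params"
  assumes u: "u absolutely_integrable_on {0<..<T}" and T: "0 < T"
    and x: "relu_solution T u x0 x" and t: "t \<in> {0..T}"
  shows "relu_trajectory T u x0 t = x t"
proof -
  have "relu_solution T u x0 (relu_trajectory T u x0)"
    unfolding relu_trajectory_def using x by (rule someI[of "relu_solution T u x0"])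
  moreover have "(\<lambda>s. norm (u s)) integrable_on {0..T}"
    using u by (simp add: absolutely_integrable_on_def integrable_on_Icc_iff_Ioo)
  ultimately show ?thesis
    using x t T unfolding relu_solution_iff_ivp
    by (intro ivp_solution_unique[OF _ _ _ _ _ relu_field_lipschitz]) auto
qed

section \<open>Margins and comparison controls\<close>

lemma sample_margin_le:
  assumes "j \<noteq> c"
  shows "sample_margin P c v \<le> (P *v v) $ c - (P *v v) $ j"
proof -
  have "(P *v v) $ j \<le> Max ((\<lambda>j. (P *v v) $ j) ` {j. j \<noteq> c})"
    using assms by (intro Max_ge) auto
  then show ?thesis
    by (simp add: sample_margin_def)
qed

text \<open>Division by the exponential of the correct score leaves only score differences, the form
  in which the margin enters.\<close>

lemma neg_ln_softmax_eq:
  fixes a :: "'m::finite \<Rightarrow> real"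
  shows "- ln (exp (a c) / (\<Sum>j\<in>UNIV. exp (a j))) = ln (1 + (\<Sum>j\<in>-{c}. exp (a j - a c)))"
proof -
  have pos: "0 < (\<Sum>j\<in>UNIV. exp (a j))"
    by (rule sum_pos) auto
  have "- ln (exp (a c) / (\<Sum>j\<in>UNIV. exp (a j))) = ln ((\<Sum>j\<in>UNIV. exp (a j)) / exp (a c))"
    using pos by (simp add: ln_div)
  also have "(\<Sum>j\<in>UNIV. exp (a j)) / exp (a c) = (\<Sum>j\<in>UNIV. exp (a j - a c))"
    by (simp add: sum_divide_distrib exp_diff)
  also have "\<dots> = 1 + (\<Sum>j\<in>-{c}. exp (a j - a c))"
    by (subst sum.remove[of _ c]) (auto simp: Compl_eq_Diff_UNIV)
  finally show ?thesis .
qed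

lemma training_error_nonneg: "0 \<le> training_error P y X"
  unfolding training_error_def neg_ln_softmax_eq
  by (intro mult_nonneg_nonneg sum_nonneg ln_ge_zero) (auto intro!: sum_nonneg)

text \<open>Each of the \<open>CARD('m) - 1\<close> wrong classes contributes at most
  \<open>exp (- M)\<close> to the logarithm of every sample, and averaging preserves the common
  bound.\<close>

lemma training_error_le_margin:
  fixes P :: "real ^ 'd ^ 'm" and y :: "'n::finite \<Rightarrow> 'm::finite"
  assumes M: "\<And>i j. j \<noteq> y i \<Longrightarrow> M \<le> (P *v X i) $ y i - (P *v X i) $ j"
  shows "training_error P y X \<le> ln (1 + (real CARD('m) - 1) * exp (- M))"
proof -
  let ?B = "ln (1 + (real CARD('m) - 1) * exp (- M))"
  have "- ln (exp ((P *v X i) $ y i) / (\<Sum>j\<in>UNIV. exp ((P *v X i) $ j))) \<le> ?B" for i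
  proof -
    let ?S = "\<Sum>j\<in>-{y i}. exp ((P *v X i) $ j - (P *v X i) $ y i)"
    have "?S \<le> real (card (-{y i})) * exp (- M)"
      using M[of _ i] by (intro sum_bounded_above) fastforce
    also have "real (card (-{y i})) = real CARD('m) - 1"
      by (simp add: Compl_eq_Diff_UNIV card_Diff_subset of_nat_diff Suc_leI)
    finally have "?S \<le> (real CARD('m) - 1) * exp (- M)" .
    moreover have "0 \<le> ?S" by (intro sum_nonneg) auto
    ultimately show ?thesis
      unfolding neg_ln_softmax_eq[of "\<lambda>j. (P *v X i) $ j"] by (intro ln_mono) auto
  qed
  then have "(\<Sum>i\<in>UNIV. - ln (exp ((P *v X i) $ y i) / (\<Sum>j\<in>UNIV. exp ((P *v X i) $ j)))) \<le> real CARD('n) * ?B"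
    by (intro sum_bounded_above) auto
  then show ?thesis
    unfolding training_error_def by (simp add: field_simps)
qed

text \<open>The perturbation changes each of the two scores by at most \<open>\<gamma> / 4\<close>,
  costing half the margin in total. The added 1 keeps the denominator positive.\<close>

lemma score_difference_perturb:
  fixes P :: "real ^ 'd ^ 'm"
  assumes \<gamma>: "\<gamma> \<le> (P *v z) $ c - (P *v z) $ j" and p: "norm (p - z) \<le> \<gamma> / (4 * (norm P + 1))"
  shows "\<gamma> / 2 \<le> (P *v p) $ c - (P *v p) $ j"
proof -
  have bound: "\<bar>(P *v (p - z)) $ k\<bar> \<le> \<gamma> / 4" for k
  proof -
    have "\<bar>(P *v (p - z)) $ k\<bar> \<le> norm (P *v (p - z))"
      by (rule component_le_norm_cart)
    also have "\<dots> \<le> norm P * norm (p - z)"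
      by (rule norm_matrix_vector_mult_le)
    also have "\<dots> \<le> (norm P + 1) * (\<gamma> / (4 * (norm P + 1)))"
      using p by (intro mult_mono) auto
    also have "\<dots> = \<gamma> / 4"
    proof -
      have "c * (\<gamma> / (4 * c)) = \<gamma> / 4" if "0 < c" for c :: real
        using that by simp
      moreover have "0 < norm P + 1"
        by (simp add: add_nonneg_pos)
      ultimately show ?thesis by blast
    qed
    finally show ?thesis .
  qed
  have "(P *v p) $ k = (P *v z) $ k + (P *v (p - z)) $ k" for k
    by (simp add: matrix_vector_mult_diff_distrib)
  then show ?thesis
    using \<gamma> bound[of c] bound[of j] by (simp add: abs_le_iff)
qed

lemma H1_imp_absolutely_integrable:
  "f \<in> H1 T \<Longrightarrow> f absolutely_integrable_on {0<..<T}"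
  unfolding H1_def by (auto intro: L2_on_imp_absolutely_integrable)

lemma H1_norm_sq_nonneg: "0 \<le> H1_norm_sq T f"
  by (simp add: H1_norm_sq_def L2_norm_sq_nonneg)

section \<open>Construction of the comparison controls\<close>

text \<open>\<open>C\<close> is fixed before \<open>R\<close>, which is what later makes the final
  constant independent of the regularisation parameter. The point \<open>p\<close> is the state at
  the switching time \<open>T2\<close>, just before the exponential growth.\<close>

lemma exists_comparison_controls:
  fixes u0 :: "real \<Rightarrow> ('d::finite) params" and z :: "'n::finite \<Rightarrow> real \<Rightarrow> real ^ 'd"
  assumes T0: "0 < T0" "T0 \<le> T" and u0: "u0 \<in> H1 T0"
    and z: "\<And>i. relu_solution T0 u0 (x0 i) (z i)"
    and x0: "\<And>i k. 0 \<le> x0 i $ k" and \<delta>: "0 < \<delta>"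
  obtains C where "0 \<le> C"
    "\<And>R. 1 \<le> R \<Longrightarrow> \<exists>v. v \<in> H1 T \<and> H1_norm_sq T v \<le> C * R\<^sup>2 \<and>
       (\<forall>i. \<exists>p. norm (p - z i T0) \<le> \<delta> \<and> relu_trajectory T v (x0 i) T = exp (2 * R) *\<^sub>R p)"
proof -
  obtain g0 where u0L: "L2_on {0<..<T0} u0" and g0: "L2_on {0<..<T0} g0" "has_weak_deriv T0 u0 g0"
    using u0 by (auto simp: H1_def)
  have T: "0 < T" using T0 by simp
  have u0int: "(\<lambda>s. norm (u0 s)) integrable_on {0..T0}"
    using L2_on_imp_absolutely_integrable[OF u0L]
    by (simp add: absolutely_integrable_on_def integrable_on_Icc_iff_Ioo)
  have "\<exists>Z. \<forall>t\<in>{0..T0}. norm (z i t) \<le> Z" for i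
  proof -
    have "bounded (z i ` {0..T0})"
      using z[of i] by (intro compact_imp_bounded compact_continuous_image) (auto simp: relu_solution_def)
    then show ?thesis by (auto simp: bounded_iff)
  qed
  then obtain Zf where Zf: "\<And>i t. t \<in> {0..T0} \<Longrightarrow> norm (z i t) \<le> Zf i"
    by metis
  define Z where "Z = Max (range Zf)"
  have Z: "norm (z i t) \<le> Z" if "t \<in> {0..T0}" for i t
  proof -
    have "Zf i \<le> Z" unfolding Z_def by (rule Max_ge) auto
    with Zf[OF that, of i] show ?thesis by linarith
  qed
  have Z0: "0 \<le> Z"
    using Z[of 0 undefined] T0 by (auto intro: order_trans[OF norm_ge_zero])
  \<comment> \<open>The factor 4 makes a displacement bound \<open>2 * \<eta> * (Z + 1)\<close> at
    most half of \<open>\<delta>\<close>, because two displacements will be added. The cap 1/2 is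
    the smallness required for the contraction and displacement lemmas.\<close>
  define \<eta> where "\<eta> = min (1/2) (\<delta> / (4 * (Z + 1)))"
  have "\<eta> \<le> \<delta> / (4 * (Z + 1))" by (simp add: \<eta>_def)
  then have "2 * \<eta> * (Z + 1) \<le> \<delta> / 2"
    using Z0 by (simp add: pos_le_divide_eq algebra_simps)
  moreover have "0 < \<delta> / (4 * (Z + 1))" using Z0 \<delta> by simp
  then have "0 < \<eta>" by (simp add: \<eta>_def)
  moreover have "\<eta> \<le> 1/2" unfolding \<eta>_def by (rule min.cobounded1)
  ultimately have \<eta>: "0 < \<eta>" "\<eta> \<le> 1/2" "2 * \<eta> * (Z + 1) \<le> \<delta> / 2"
    by auto
  have "continuous_on {0..T0} (\<lambda>t. integral {t..T0} (\<lambda>s. norm (u0 s)))"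
    by (rule indefinite_integral_continuous_1'[OF u0int])
  then obtain \<epsilon> where \<epsilon>: "\<epsilon> > 0" "\<And>t. t \<in> {0..T0} \<Longrightarrow> dist t T0 < \<epsilon> \<Longrightarrow>
      dist (integral {t..T0} (\<lambda>s. norm (u0 s))) (integral {T0..T0} (\<lambda>s. norm (u0 s))) < \<eta>"
    using \<eta>(1) T0(1) unfolding continuous_on_iff by (metis atLeastAtMost_iff less_eq_real_def)
  \<comment> \<open>\<open>T1\<close> is late enough for the rest of \<open>u0\<close> to have
    integral at most \<open>\<eta>\<close>; the maximum with \<open>T0 / 2\<close> keeps it
    positive.\<close>
  define T1 where "T1 = max (T0 / 2) (T0 - \<epsilon> / 2)"
  have T1: "0 < T1" "T1 < T0" "dist T1 T0 < \<epsilon>"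
    using T0 \<epsilon>(1) by (auto simp: T1_def dist_real_def max_def)
  have tail: "integral {T1..T0} (\<lambda>s. norm (u0 s)) \<le> \<eta>"
    using \<epsilon>(2)[of T1] T1 by (auto simp: dist_real_def)
  \<comment> \<open>Ending the switch-off strictly before \<open>T0\<close> gives the strict
    inequality demanded by \<open>has_weak_deriv_cutoff\<close>, and leaves time for growth even
    when \<open>T = T0\<close>.\<close>
  define T2 where "T2 = (T1 + T0) / 2"
  have T2: "T1 < T2" "T2 < T0" "T2 < T"
    using T1 T0 by (auto simp: T2_def)
  \<comment> \<open>The inner truncated square is 0 up to \<open>T1\<close> and at least 1 from
    \<open>T2\<close> on; the outer one turns this into a C1 descent from 1 to 0.\<close>
  define \<rho> where "\<rho> t = pos_sq (1 - pos_sq ((t - T1) / (T2 - T1)))" for t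
  define \<rho>' where "\<rho>' t = 2 * max 0 (1 - pos_sq ((t - T1) / (T2 - T1))) *
      - (2 * max 0 ((t - T1) / (T2 - T1)) * (1 / (T2 - T1)))" for t
  have \<rho>: "(\<rho> has_real_derivative \<rho>' t) (at t)" for t
    unfolding \<rho>_def[abs_def] \<rho>'_def using T2
    by (auto intro!: derivative_eq_intros)
  have \<rho>'_cont: "continuous_on UNIV \<rho>'"
    unfolding \<rho>'_def[abs_def] by (intro continuous_intros) (use T2 in auto)
  have \<rho>_cont: "continuous_on UNIV \<rho>"
    unfolding \<rho>_def[abs_def] by (intro continuous_intros) (use T2 in auto)
  have "1 \<le> pos_sq ((t - T1) / (T2 - T1))" if "T2 \<le> t" for t
    using that T2 by (simp add: pos_sq_def max_def one_le_power field_simps)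
  then have \<rho>_T2: "\<rho> t = 0" "\<rho>' t = 0" if "T2 \<le> t" for t
    using that by (auto simp: \<rho>_def \<rho>'_def)
  have \<rho>_T1: "\<rho> t = 1" if "t \<le> T1" for t
  proof -
    have "pos_sq ((t - T1) / (T2 - T1)) = 0"
      using that T2 by (simp add: divide_nonpos_pos)
    then show ?thesis by (simp add: \<rho>_def) (simp add: pos_sq_def)
  qed
  have \<rho>_le: "\<bar>\<rho> t\<bar> \<le> 1" for t
    using pos_sq_nonneg[of "(t - T1) / (T2 - T1)"]
    by (auto simp: \<rho>_def pos_sq_def[of "1 - _"] max_def intro!: power_le_one)
  \<comment> \<open>\<open>\<Psi>\<close> is a multiple of the cubed positive part of
    \<open>t - T2\<close> and \<open>\<psi>\<close> its derivative, a C1 function vanishing up to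
    \<open>T2\<close>. The factor \<open>\<kappa>\<close> normalises \<open>\<Psi> T\<close> to
    2.\<close>
  define \<kappa> where "\<kappa> = 2 / ((T - T2) * pos_sq (T - T2))"
  define \<Psi> where "\<Psi> t = \<kappa> * ((t - T2) * pos_sq (t - T2))" for t
  define \<psi> where "\<psi> t = 3 * \<kappa> * pos_sq (t - T2)" for t
  define \<psi>' where "\<psi>' t = 3 * \<kappa> * (2 * max 0 (t - T2))" for t
  have \<kappa>: "0 < \<kappa>" using T2 by (simp add: \<kappa>_def)
  have \<Psi>T: "\<Psi> T = 2" using T2 by (simp add: \<Psi>_def \<kappa>_def)
  have \<Psi>: "(\<Psi> has_real_derivative \<psi> t) (at t)" for t
  proof -
    have "(\<Psi> has_real_derivative \<kappa> * (pos_sq (t - T2) + (t - T2) * (2 * max 0 (t - T2)))) (at t)"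
      unfolding \<Psi>_def[abs_def] by (auto intro!: derivative_eq_intros)
    moreover have "(t - T2) * (2 * max 0 (t - T2)) = 2 * pos_sq (t - T2)"
      by (simp add: pos_sq_def max_def power2_eq_square)
    ultimately show ?thesis by (simp add: \<psi>_def ac_simps)
  qed
  have \<psi>: "(\<psi> has_real_derivative \<psi>' t) (at t)" for t
    unfolding \<psi>_def[abs_def] \<psi>'_def by (auto intro!: derivative_eq_intros)
  have \<psi>'_cont: "continuous_on UNIV \<psi>'"
    unfolding \<psi>'_def[abs_def] by (intro continuous_intros)
  have \<psi>_cont: "continuous_on UNIV \<psi>"
    unfolding \<psi>_def[abs_def] by (intro continuous_intros)
  have \<psi>0: "0 \<le> \<psi> t" for t using \<kappa> by (simp add: \<psi>_def)
  have \<psi>_T2: "\<psi> t = 0" if "t \<le> T2" for t using that by (simp add: \<psi>_def)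
  define e :: "'d params" where "e = (mat 1, 0)"
  define v1 where "v1 t = \<rho> t *\<^sub>R u0 t" for t
  define g1 where "g1 t = \<rho> t *\<^sub>R g0 t + \<rho>' t *\<^sub>R u0 t" for t
  define v2 where "v2 t = \<psi> t *\<^sub>R e" for t
  define g2 where "g2 t = \<psi>' t *\<^sub>R e" for t
  have v1L: "L2_on {0<..<T} v1"
    unfolding v1_def[abs_def] using T2 T0
    by (intro L2_on_mult[OF u0L \<rho>_cont]) (auto intro: \<rho>_T2)
  have g1L: "L2_on {0<..<T} g1"
    unfolding g1_def[abs_def] using T2 T0
    by (intro L2_on_add L2_on_mult[OF g0(1) \<rho>_cont] L2_on_mult[OF u0L \<rho>'_cont]) (auto intro: \<rho>_T2)
  have v2L: "L2_on {0<..<T} v2"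
    unfolding v2_def[abs_def] by (rule L2_on_mult[OF L2_on_const \<psi>_cont order_refl]) auto
  have g2L: "L2_on {0<..<T} g2"
    unfolding g2_def[abs_def] by (rule L2_on_mult[OF L2_on_const \<psi>'_cont order_refl]) auto
  have wd1: "has_weak_deriv T v1 g1"
    unfolding v1_def[abs_def] g1_def[abs_def]
    using L2_on_imp_absolutely_integrable[OF u0L] L2_on_imp_absolutely_integrable[OF g0(1)]
      g0(2) \<rho> \<rho>'_cont \<rho>_T2 T2(2) T0(2)
    by (rule has_weak_deriv_cutoff)
  have wd2: "has_weak_deriv T v2 g2"
    unfolding v2_def[abs_def] g2_def[abs_def] by (rule has_weak_deriv_C1[OF \<psi> \<psi>'_cont T])
  let ?n = "L2_norm_sq {0<..<T}"
  \<comment> \<open>The 2 comes from the squared triangle inequality. Terms without \<open>R\<close>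
    are also charged to \<open>R\<^sup>2\<close>, which is at least 1.\<close>
  define C where "C = 2 * (?n v1 + ?n v2 + ?n g1 + ?n g2)"
  have nn: "0 \<le> ?n v1" "0 \<le> ?n v2" "0 \<le> ?n g1" "0 \<le> ?n g2"
    by (auto intro: L2_norm_sq_nonneg)
  show thesis
  proof (rule that[of C])
    show "0 \<le> C" using nn by (simp add: C_def)
    fix R :: real assume R: "1 \<le> R"
    define v where "v t = v1 t + R *\<^sub>R v2 t" for t
    define g where "g t = g1 t + R *\<^sub>R g2 t" for t
    have vL: "L2_on {0<..<T} v" and vn: "?n v \<le> 2 * ?n v1 + 2 * (R\<^sup>2 * ?n v2)"
      using L2_on_add[OF v1L L2_on_scaleR(1)[OF v2L, of R]]
      by (auto simp: v_def[abs_def] L2_on_scaleR(2)[OF v2L])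
    have gL: "L2_on {0<..<T} g" and gn: "?n g \<le> 2 * ?n g1 + 2 * (R\<^sup>2 * ?n g2)"
      using L2_on_add[OF g1L L2_on_scaleR(1)[OF g2L, of R]]
      by (auto simp: g_def[abs_def] L2_on_scaleR(2)[OF g2L])
    have wd: "has_weak_deriv T v g"
      unfolding v_def[abs_def] g_def[abs_def]
      by (intro has_weak_deriv_add has_weak_deriv_scaleR wd1 wd2
          L2_on_imp_absolutely_integrable L2_on_scaleR v1L v2L g1L g2L)
    have R2: "1 \<le> R\<^sup>2" using R by (simp add: one_le_power)
    have vH: "v \<in> H1 T" and "H1_norm_sq T v = ?n v + ?n g"
      using H1_norm_sq_eq[OF vL gL wd T] by auto
    moreover have "?n v1 \<le> R\<^sup>2 * ?n v1" "?n g1 \<le> R\<^sup>2 * ?n g1"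
      using mult_right_mono[OF R2 nn(1)] mult_right_mono[OF R2 nn(3)] by auto
    ultimately have norm: "H1_norm_sq T v \<le> C * R\<^sup>2"
      using vn gn by (simp add: C_def algebra_simps)
    have vint: "v absolutely_integrable_on {0<..<T}"
      by (rule L2_on_imp_absolutely_integrable[OF vL])
    then have vint0: "v absolutely_integrable_on {0..T}"
      by (simp add: absolutely_integrable_on_Icc_iff_Ioo)
    have vint12: "v absolutely_integrable_on {T1..T2}"
      by (rule set_integrable_subset[OF vint0]) (use T1 T2 T0 in auto)
    then have nvint: "(\<lambda>s. norm (v s)) integrable_on {T1..T2}"
      by (simp add: absolutely_integrable_on_def)
    have u0int12: "(\<lambda>s. norm (u0 s)) integrable_on {T1..T0}"
      by (rule integrable_subinterval_real[OF u0int]) (use T1 in auto)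
    \<comment> \<open>Up to \<open>T2\<close> the growth term is absent and \<open>\<rho>\<close> is
      at most 1 in absolute value, so this bound on the control does not involve
      \<open>R\<close>.\<close>
    have "integral {T1..T2} (\<lambda>s. norm (v s)) \<le> integral {T1..T2} (\<lambda>s. norm (u0 s))"
    proof (rule integral_le[OF nvint])
      show "(\<lambda>s. norm (u0 s)) integrable_on {T1..T2}"
        by (rule integrable_subinterval_real[OF u0int12]) (use T2 in auto)
      fix s assume "s \<in> {T1..T2}"
      then show "norm (v s) \<le> norm (u0 s)"
        using \<rho>_le[of s] by (simp add: v_def v1_def v2_def \<psi>_T2 mult_left_le_one_le)
    qed
    also have "\<dots> \<le> integral {T1..T0} (\<lambda>s. norm (u0 s))"
      by (intro integral_subset_le integrable_subinterval_real[OF u0int12]) (use T2 in auto)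
    finally have vtail: "integral {T1..T2} (\<lambda>s. norm (v s)) \<le> \<eta>"
      using tail by simp
    then have half: "integral {T1..T2} (\<lambda>s. norm (v s)) \<le> 1/2"
      using \<eta>(2) by linarith
    have "\<exists>p. norm (p - z i T0) \<le> \<delta> \<and> relu_trajectory T v (x0 i) T = exp (2 * R) *\<^sub>R p" for i
    proof -
      have zi: "ivp_solution (relu_field u0) 0 T0 (x0 i) (z i)"
        using z by (simp add: relu_solution_iff_ivp)
      have "ivp_solution (relu_field u0) 0 T1 (x0 i) (z i)"
        by (rule ivp_solution_restrict[OF zi]) (use T1 in auto)
      then have s1: "ivp_solution (relu_field v) 0 T1 (x0 i) (z i)"
        by (rule ivp_solution_cong)
          (use T2 in \<open>auto simp: relu_field_def v_def v1_def v2_def \<rho>_T1 \<psi>_T2\<close>)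
      \<comment> \<open>The trajectory is \<open>z i\<close> up to \<open>T1\<close>, then
        \<open>y\<close>, then an exponential. Only the middle piece is not explicit, and the
        control is small enough there for a single contraction to produce it.\<close>
      obtain y where y: "ivp_solution (relu_field v) T1 T2 (z i T1) y"
        by (rule ivp_solution_exists_short[OF less_imp_le[OF T2(1)] nvint norm_ge_zero half
              relu_field_lipschitz relu_field_integrable[OF vint12]])
      have y0: "0 \<le> y T2 $ k" for k
        by (rule relu_solution_nonneg[OF y]) (use T1 T2 relu_solution_nonneg[OF zi _ x0] in auto)
      have s3: "ivp_solution (relu_field v) T2 T (y T2) (\<lambda>t. exp (R * \<Psi> t) *\<^sub>R y T2)"
      proof (rule relu_solution_exponential[where \<psi>="\<lambda>t. R * \<psi> t"])
        show "((\<lambda>t. R * \<Psi> t) has_real_derivative R * \<psi> t) (at t)" for t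
          by (rule DERIV_cmult[OF \<Psi>])
        show "v t = (R * \<psi> t) *\<^sub>R (mat 1, 0)" if "t \<in> {T2..T}" for t
          using that by (simp add: v_def v1_def v2_def e_def \<rho>_T2)
      qed (use R \<psi>0 y0 in \<open>auto simp: \<Psi>_def\<close>)
      let ?w = "\<lambda>t. if t \<le> T1 then z i t else y t"
      have s12: "ivp_solution (relu_field v) 0 T2 (x0 i) ?w"
        by (rule ivp_solution_concat[OF s1 y]) (use T1 T2 in auto)
      have wT2: "?w T2 = y T2" using T2 by simp
      have "ivp_solution (relu_field v) 0 T (x0 i) (\<lambda>t. if t \<le> T2 then ?w t else exp (R * \<Psi> t) *\<^sub>R y T2)"
        by (rule ivp_solution_concat[OF s12]) (use s3 T1 T2 wT2 in auto)
      then have "relu_trajectory T v (x0 i) T = exp (2 * R) *\<^sub>R y T2"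
        using relu_trajectory_eq[OF vint T, of "x0 i" _ T] T T2 \<Psi>T
        by (auto simp: relu_solution_iff_ivp mult.commute)
      \<comment> \<open>Both \<open>y T2\<close> and \<open>z i T0\<close> lie within half of
        \<open>\<delta>\<close> of the common state \<open>z i T1\<close>.\<close>
      moreover have "norm (y T2 - z i T0) \<le> \<delta>"
      proof -
        have zT1: "norm (z i T1) \<le> Z" using Z[of T1 i] T1 by auto
        have small: "2 * \<eta> * (norm (z i T1) + 1) \<le> \<delta> / 2"
          using \<eta>(3) zT1 mult_left_mono[of "norm (z i T1) + 1" "Z + 1" "2 * \<eta>"] \<eta>(1) by linarith
        have "norm (y T2 - z i T1) \<le> 2 * \<eta> * (norm (z i T1) + 1)"
          by (rule relu_solution_displacement_le[OF y _ nvint vtail \<eta>(2)]) (use T2 in auto)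
        moreover have "ivp_solution (relu_field u0) T1 T0 (z i T1) (z i)"
          using ivp_solution_increment[OF zi, of T1] T1 zi
          by (auto simp: ivp_solution_def intro: continuous_on_subset)
        then have "norm (z i T0 - z i T1) \<le> 2 * \<eta> * (norm (z i T1) + 1)"
          by (rule relu_solution_displacement_le[OF _ _ u0int12 tail \<eta>(2)]) (use T1 in auto)
        ultimately show ?thesis
          using small norm_triangle_ineq4[of "y T2 - z i T1" "z i T0 - z i T1"] by simp
      qed
      ultimately show ?thesis by blast
    qed
    with vH norm show "\<exists>v. v \<in> H1 T \<and> H1_norm_sq T v \<le> C * R\<^sup>2 \<and>
       (\<forall>i. \<exists>p. norm (p - z i T0) \<le> \<delta> \<and> relu_trajectory T v (x0 i) T = exp (2 * R) *\<^sub>R p)"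
      by blast
  qed
qed

section \<open>Comparison with the minimizer\<close>

theorem theorem3p4:
  fixes xs :: "'n::finite \<Rightarrow> real ^ 'd::finite"
    and ys :: "'n \<Rightarrow> 'm::finite"
    and Q :: "real ^ 'd \<Rightarrow> real ^ 'd"
    and P :: "real ^ 'd ^ 'm"
    and T\<^sub>0 T \<gamma> :: real
    and u\<^sub>0 :: "real \<Rightarrow> 'd params"
    and z :: "'n \<Rightarrow> real \<Rightarrow> real ^ 'd"
  assumes "CARD('m) \<ge> 2"
    and "inj xs"
    and "\<exists>A c. \<forall>v. Q v = A *v v + c"
    and "Q \<noteq> (\<lambda>v. 0)"
    and "\<forall>i k. Q (xs i) $ k \<ge> 0"
    and "P \<noteq> 0"
    and "T\<^sub>0 > 0"
    and "u\<^sub>0 \<in> H1 T\<^sub>0"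
    and "\<forall>i. relu_solution T\<^sub>0 u\<^sub>0 (Q (xs i)) (z i)"
    and "\<forall>i. sample_margin P (ys i) (z i T\<^sub>0) > 0"
    and "\<gamma> = margin P ys (\<lambda>i. z i T\<^sub>0)"
    and "T \<ge> T\<^sub>0"
  shows "\<exists>C>0. \<forall>lam>0. \<forall>u x.
           is_arg_min (J_functional P ys (\<lambda>i. Q (xs i)) lam T) (\<lambda>v. v \<in> H1 T) u \<and>
           (\<forall>i. relu_solution T u (Q (xs i)) (x i)) \<longrightarrow>
           (\<forall>\<alpha>. 0 < \<alpha> \<and> \<alpha> < 1/2 \<longrightarrow>
              training_error P ys (\<lambda>i. x i T)
              \<le> ln (1 + (real CARD('m) - 1) * exp (- \<gamma> * exp (lam powr (- \<alpha>) / 2)))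
                 + C * lam powr (- 2 * \<alpha> + 1))"
proof -
  let ?x0 = "\<lambda>i. Q (xs i)"
  let ?E = "\<lambda>X. training_error P ys X"
  have T: "0 < T" using assms by simp
  have m: "0 \<le> real CARD('m) - 1" using assms(1) by simp
  have \<gamma>_le: "\<gamma> \<le> sample_margin P (ys i) (z i T\<^sub>0)" for i
    unfolding assms margin_def by (rule Min_le) auto
  have "\<gamma> \<in> range (\<lambda>i. sample_margin P (ys i) (z i T\<^sub>0))"
    unfolding assms margin_def by (rule Min_in) auto
  then have \<gamma>: "0 < \<gamma>" using assms by auto
  define \<delta> where "\<delta> = \<gamma> / (4 * (norm P + 1))"
  have \<delta>: "0 < \<delta>"
    using \<gamma> norm_ge_zero[of P] by (simp add: \<delta>_def add_nonneg_pos)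
  obtain C where C: "0 \<le> C"
    "\<And>R. 1 \<le> R \<Longrightarrow> \<exists>v. v \<in> H1 T \<and> H1_norm_sq T v \<le> C * R\<^sup>2 \<and>
       (\<forall>i. \<exists>p. norm (p - z i T\<^sub>0) \<le> \<delta> \<and> relu_trajectory T v (?x0 i) T = exp (2 * R) *\<^sub>R p)"
    using exists_comparison_controls[of T\<^sub>0 T u\<^sub>0 ?x0 z \<delta>] assms \<delta> by blast
  have E0: "0 \<le> ?E ?x0" by (rule training_error_nonneg)
  show ?thesis
  \<comment> \<open>One summand serves each range of \<open>lam\<close>: \<open>C\<close> for
    \<open>lam < 1\<close> and the initial error for \<open>lam \<ge> 1\<close>. The added 1 ensures
    positivity.\<close>
  proof (intro exI[of _ "C + ?E ?x0 + 1"] conjI allI impI)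
    show "0 < C + ?E ?x0 + 1" using C(1) E0 by simp
    fix lam :: real and u :: "real \<Rightarrow> 'd params" and x and \<alpha> :: real
    assume lam: "0 < lam"
      and ux: "is_arg_min (J_functional P ys ?x0 lam T) (\<lambda>v. v \<in> H1 T) u \<and>
           (\<forall>i. relu_solution T u (Q (xs i)) (x i))"
      and \<alpha>: "0 < \<alpha> \<and> \<alpha> < 1/2"
    let ?J = "J_functional P ys ?x0 lam T"
    let ?B = "ln (1 + (real CARD('m) - 1) * exp (- \<gamma> * exp (lam powr (- \<alpha>) / 2)))"
    have uH: "u \<in> H1 T" and min: "\<And>v. v \<in> H1 T \<Longrightarrow> ?J u \<le> ?J v"
      using ux unfolding is_arg_min_def by (auto simp: not_less)
    have "relu_trajectory T u (?x0 i) T = x i T" for i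
      using relu_trajectory_eq[OF H1_imp_absolutely_integrable[OF uH] T, of "?x0 i" "x i" T] ux T by auto
    \<comment> \<open>The penalty is nonnegative, so the error of the minimizer is bounded by its
      cost and hence by the cost of any competitor.\<close>
    then have "?E (\<lambda>i. x i T) \<le> ?J u"
      using lam H1_norm_sq_nonneg[of T u] by (simp add: J_functional_def)
    then have EJ: "?E (\<lambda>i. x i T) \<le> ?J v" if "v \<in> H1 T" for v
      using min[OF that] by linarith
    have B0: "0 \<le> ?B"
      using m by (intro ln_ge_zero) simp
    show "?E (\<lambda>i. x i T) \<le> ?B + (C + ?E ?x0 + 1) * lam powr (- 2 * \<alpha> + 1)"
    proof (cases "1 \<le> lam")
      case True
      have "has_weak_deriv T (\<lambda>t. 0 *\<^sub>R (0 :: 'd params)) (\<lambda>t. 0 *\<^sub>R 0)"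
        by (rule has_weak_deriv_C1) (use T in \<open>auto intro!: derivative_eq_intros\<close>)
      then have zero: "(\<lambda>t. 0 :: 'd params) \<in> H1 T" "H1_norm_sq T (\<lambda>t. 0 :: 'd params) = 0"
        using H1_norm_sq_eq[OF L2_on_const[of T 0] L2_on_const[of T 0] _ T]
        by (auto simp: L2_norm_sq_def)
      have "relu (0 :: real ^ 'd) = 0"
        by (simp add: relu_def vec_eq_iff)
      then have "relu_solution T (\<lambda>t. 0) (?x0 i) (\<lambda>t. ?x0 i)" for i
        by (simp add: relu_solution_def)
      then have "relu_trajectory T (\<lambda>t. 0) (?x0 i) T = ?x0 i" for i
        using relu_trajectory_eq[OF H1_imp_absolutely_integrable[OF zero(1)] T,
            of "?x0 i" "\<lambda>t. ?x0 i" T] T by simp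
      then have "?J (\<lambda>t. 0) = ?E ?x0"
        by (simp add: J_functional_def zero(2))
      then have "?E (\<lambda>i. x i T) \<le> ?E ?x0 * 1"
        using EJ[OF zero(1)] by simp
      \<comment> \<open>The exponent \<open>- 2 * \<alpha> + 1\<close> is positive, so the power of
        \<open>lam\<close> is at least 1 here.\<close>
      also have "\<dots> \<le> (C + ?E ?x0 + 1) * lam powr (- 2 * \<alpha> + 1)"
        using True \<alpha> C(1) E0 by (intro mult_mono ge_one_powr_ge_zero) auto
      finally show ?thesis using B0 by linarith
    next
      case False
      define R where "R = lam powr (- \<alpha>)"
      have "1 powr (- \<alpha>) \<le> lam powr (- \<alpha>)"
        using False lam \<alpha> by (intro powr_mono2') auto
      then have R: "1 \<le> R" by (simp add: R_def)
      obtain v where v: "v \<in> H1 T" "H1_norm_sq T v \<le> C * R\<^sup>2"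
        "\<And>i. \<exists>p. norm (p - z i T\<^sub>0) \<le> \<delta> \<and> relu_trajectory T v (?x0 i) T = exp (2 * R) *\<^sub>R p"
        using C(2)[OF R] by blast
      have "?E (\<lambda>i. relu_trajectory T v (?x0 i) T)
          \<le> ln (1 + (real CARD('m) - 1) * exp (- (\<gamma> * exp (R / 2))))"
      proof (rule training_error_le_margin)
        fix i j assume j: "j \<noteq> ys i"
        obtain p where p: "norm (p - z i T\<^sub>0) \<le> \<delta>" "relu_trajectory T v (?x0 i) T = exp (2 * R) *\<^sub>R p"
          using v(3) by blast
        have "\<gamma> / 2 \<le> (P *v p) $ ys i - (P *v p) $ j"
          using score_difference_perturb[of \<gamma> P "z i T\<^sub>0" "ys i" j p] \<gamma>_le[of i] sample_margin_le[OF j, of P "z i T\<^sub>0"] p(1)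
          by (simp add: \<delta>_def)
        then have "exp (2 * R) * (\<gamma> / 2) \<le> exp (2 * R) * ((P *v p) $ ys i - (P *v p) $ j)"
          by (intro mult_left_mono) auto
        \<comment> \<open>Growth by \<open>exp (2 * R)\<close> exceeds the required
          \<open>exp (R / 2)\<close> by the factor \<open>exp (3 * R / 2)\<close>, which is at least
          2 for \<open>R \<ge> 1\<close> and so repays the halved margin.\<close>
        moreover have "\<gamma> * exp (R / 2) \<le> exp (2 * R) * (\<gamma> / 2)"
        proof -
          have "2 \<le> exp (3 * R / 2)"
            using exp_ge_add_one_self[of "3 * R / 2"] R by linarith
          then have "exp (R / 2) * 2 \<le> exp (R / 2) * exp (3 * R / 2)"
            by (intro mult_left_mono) auto
          also have "\<dots> = exp (2 * R)"
            by (simp add: exp_add[symmetric] field_simps)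
          finally show ?thesis
            using \<gamma> by simp
        qed
        ultimately show "\<gamma> * exp (R / 2) \<le> (P *v relu_trajectory T v (?x0 i) T) $ ys i
            - (P *v relu_trajectory T v (?x0 i) T) $ j"
          by (simp add: p(2) matrix_vector_mult_scaleR right_diff_distrib)
      qed
      then have "?E (\<lambda>i. relu_trajectory T v (?x0 i) T) \<le> ?B"
        by (simp add: R_def)
      moreover have "lam * H1_norm_sq T v \<le> lam * (C * R\<^sup>2)"
        using v(2) lam by (intro mult_left_mono) auto
      moreover have "lam * R\<^sup>2 = lam powr (- 2 * \<alpha> + 1)"
        using lam by (simp add: R_def power2_eq_square powr_add[symmetric] powr_mult_base)
      then have "lam * (C * R\<^sup>2) = C * lam powr (- 2 * \<alpha> + 1)"
        by (metis mult.left_commute)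
      moreover have "C * lam powr (- 2 * \<alpha> + 1) \<le> (C + ?E ?x0 + 1) * lam powr (- 2 * \<alpha> + 1)"
        using E0 by (intro mult_right_mono) auto
      ultimately show ?thesis
        using EJ[OF v(1)] by (simp add: J_functional_def)
    qed
  qed
qed

end
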